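(* Let $X$ be a compact metrizable space. Then $X$ is weakly chained if and only if $X$ is pointed 1-movable.
   Context: Weakly chained: fix any metric $d$ compatible with the topology of $X$ (the notion does not depend on the choice for compact $X$). For $\varepsilon>0$ an $\varepsilon$-chain is a finite sequence $\{x_0,\dots,x_n\}$ with $d(x_i,x_{i+1})<\varepsilon$ for all $i$. An $\varepsilon$-homotopy between $\varepsilon$-chains with the same endpoints is a finite sequence of $\varepsilon$-chains with the same endpoints, each differing from the next by adding or removing a single point (never an endpoint); $[\alpha]_\varepsilon$ is the $\varepsilon$-homotopy class and $[x,y]_\varepsilon$ the class of $\{x,y\}$. $X$ is chain connected if every two points are joined by an $\varepsilon$-chain for every $\varepsilon>0$. $X$ is weakly chained if it is chain connected and for every $\varepsilon>0$ there is $\delta>0$ such that whenever $d(x,y)<\delta$, for every $\tau>0$ there is a $\tau$-chain $\alpha$ (which is also an $\varepsilon$-chain) from $x$ to $y$ with $[\alpha]_\varepsilon=[x,y]_\varepsilon$. Pointed 1-movable (standard shape-theoretic notion): embed $X$ in the Hilbert cube $Q$ and let $x_0\in X$ be a basepoint. $X$ is pointed 1-movable if for every neighborhood $U$ of $X$ in $Q$ there is a neighborhood $V\subset U$ of $X$ such that for every neighborhood $W$ of $X$, every loop in $V$ based at $x_0$ is homotopic in $U$, relative to the basepoint, to a loop in $W$. For continua this is independent of the embedding and of $x_0$.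
   Formalization: Pointed 1-movable is taken to include connectedness of X (and X is nonempty, having a basepoint); with the loop condition alone the claim fails, since a two-point discrete space satisfies it but is not chain connected. *)

theory Defs
  imports "HOL-Analysis.Analysis"
begin

section \<open>Chains and weakly chained spaces\<close>

definition eps_chain :: "'a set \<Rightarrow> ('a \<Rightarrow> 'a \<Rightarrow> real) \<Rightarrow> real \<Rightarrow> 'a list \<Rightarrow> bool" where
  "eps_chain M d \<epsilon> xs \<longleftrightarrow> xs \<noteq> [] \<and> set xs \<subseteq> M \<and> successively (\<lambda>x y. d x y < \<epsilon>) xs"

definition eps_chain_from_to ::
  "'a set \<Rightarrow> ('a \<Rightarrow> 'a \<Rightarrow> real) \<Rightarrow> real \<Rightarrow> 'a \<Rightarrow> 'a \<Rightarrow> 'a list \<Rightarrow> bool" where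
  "eps_chain_from_to M d \<epsilon> x y xs \<longleftrightarrow> eps_chain M d \<epsilon> xs \<and> hd xs = x \<and> last xs = y"

text \<open>
  A single insertion; requiring both surrounding segments to be nonempty is what keeps the
  endpoints untouched.
\<close>
definition eps_insertion ::
  "'a set \<Rightarrow> ('a \<Rightarrow> 'a \<Rightarrow> real) \<Rightarrow> real \<Rightarrow> 'a list \<Rightarrow> 'a list \<Rightarrow> bool" where
  "eps_insertion M d \<epsilon> \<alpha> \<beta> \<longleftrightarrow>
     eps_chain M d \<epsilon> \<alpha> \<and> eps_chain M d \<epsilon> \<beta> \<and>
     (\<exists>us p vs. us \<noteq> [] \<and> vs \<noteq> [] \<and> \<alpha> = us @ vs \<and> \<beta> = us @ p # vs)"

definition eps_move ::
  "'a set \<Rightarrow> ('a \<Rightarrow> 'a \<Rightarrow> real) \<Rightarrow> real \<Rightarrow> 'a list \<Rightarrow> 'a list \<Rightarrow> bool" where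
  "eps_move M d \<epsilon> \<alpha> \<beta> \<longleftrightarrow> eps_insertion M d \<epsilon> \<alpha> \<beta> \<or> eps_insertion M d \<epsilon> \<beta> \<alpha>"

definition eps_homotopic ::
  "'a set \<Rightarrow> ('a \<Rightarrow> 'a \<Rightarrow> real) \<Rightarrow> real \<Rightarrow> 'a list \<Rightarrow> 'a list \<Rightarrow> bool" where
  "eps_homotopic M d \<epsilon> \<alpha> \<beta> \<longleftrightarrow>
     eps_chain M d \<epsilon> \<alpha> \<and> eps_chain M d \<epsilon> \<beta> \<and> (eps_move M d \<epsilon>)\<^sup>*\<^sup>* \<alpha> \<beta>"

definition eps_class ::
  "'a set \<Rightarrow> ('a \<Rightarrow> 'a \<Rightarrow> real) \<Rightarrow> real \<Rightarrow> 'a list \<Rightarrow> 'a list set" where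
  "eps_class M d \<epsilon> \<alpha> = {\<beta>. eps_homotopic M d \<epsilon> \<alpha> \<beta>}"

definition chain_connected :: "'a set \<Rightarrow> ('a \<Rightarrow> 'a \<Rightarrow> real) \<Rightarrow> bool" where
  "chain_connected M d \<longleftrightarrow>
     (\<forall>x\<in>M. \<forall>y\<in>M. \<forall>\<epsilon>>0. \<exists>\<alpha>. eps_chain_from_to M d \<epsilon> x y \<alpha>)"

text \<open>
  The class of \<open>[x, y]\<close> only makes sense when \<open>d x y < \<epsilon>\<close>.  Otherwise \<open>eps_class M d \<epsilon> [x, y]\<close>
  is empty while the class of the \<open>\<epsilon>\<close>-chain \<open>\<alpha>\<close> is not, so the equation below fails;
  a \<open>\<delta>\<close> exceeding \<open>\<epsilon>\<close> therefore gains nothing.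
\<close>
definition weakly_chained :: "'a set \<Rightarrow> ('a \<Rightarrow> 'a \<Rightarrow> real) \<Rightarrow> bool" where
  "weakly_chained M d \<longleftrightarrow>
     chain_connected M d \<and>
     (\<forall>\<epsilon>>0. \<exists>\<delta>>0. \<forall>x\<in>M. \<forall>y\<in>M. d x y < \<delta> \<longrightarrow>
        (\<forall>\<tau>>0. \<exists>\<alpha>. eps_chain_from_to M d \<tau> x y \<alpha> \<and> eps_chain M d \<epsilon> \<alpha> \<and>
                   eps_class M d \<epsilon> \<alpha> = eps_class M d \<epsilon> [x, y]))"


section \<open>Pointed 1-movability\<close>

text \<open>The type \<^typ>\<open>nat \<Rightarrow> real\<close> carries the product topology.\<close>
definition hilbert_cube :: "(nat \<Rightarrow> real) set" where
  "hilbert_cube = {f. \<forall>n. f n \<in> {0..1}}"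

definition cube_nbhd :: "(nat \<Rightarrow> real) set \<Rightarrow> (nat \<Rightarrow> real) set \<Rightarrow> bool" where
  "cube_nbhd S U \<longleftrightarrow> U \<subseteq> hilbert_cube \<and>
     (\<exists>G. openin (top_of_set hilbert_cube) G \<and> S \<subseteq> G \<and> G \<subseteq> U)"

definition loop_in :: "'a::topological_space set \<Rightarrow> 'a \<Rightarrow> (real \<Rightarrow> 'a) \<Rightarrow> bool" where
  "loop_in S p g \<longleftrightarrow> path g \<and> path_image g \<subseteq> S \<and> pathstart g = p \<and> pathfinish g = p"

definition pointed_1_movable_in_cube :: "(nat \<Rightarrow> real) set \<Rightarrow> (nat \<Rightarrow> real) \<Rightarrow> bool" where
  "pointed_1_movable_in_cube S p \<longleftrightarrow>
     (\<forall>U. cube_nbhd S U \<longrightarrow>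
       (\<exists>V. cube_nbhd S V \<and> V \<subseteq> U \<and>
         (\<forall>W. cube_nbhd S W \<longrightarrow>
           (\<forall>g. loop_in V p g \<longrightarrow> (\<exists>h. loop_in W p h \<and> homotopic_paths U g h)))))"

text \<open>
  Pointed 1-movability is a notion for connected spaces: the condition on loops only sees the
  part of the space near the component of the base point.  Connectedness is therefore part of
  the definition.  Without it a two-point discrete space would qualify, although it is not
  chain connected.
\<close>
definition pointed_1_movable ::
  "'a topology \<Rightarrow> ('a \<Rightarrow> nat \<Rightarrow> real) \<Rightarrow> 'a \<Rightarrow> bool" where
  "pointed_1_movable X e x\<^sub>0 \<longleftrightarrow>
     connected_space X \<and> pointed_1_movable_in_cube (e ` topspace X) (e x\<^sub>0)"

end

theory Submission
  imports Defs
begin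

text \<open>
  Chains in a compact subset \<open>S\<close> of the Hilbert cube and paths near \<open>S\<close> determine each other, and
  so do their homotopies. A small ball of the cube is convex, so an \<open>\<epsilon>\<close>-chain in \<open>S\<close> can be
  joined up by straight edges to a path in the \<open>\<epsilon>\<close>-neighbourhood of \<open>S\<close>; inserting a point into
  the chain changes this path by a homotopy inside one ball (\<open>homotopic_polygon\<close>). Conversely, a
  homotopy of paths in the \<open>r\<close>-neighbourhood can be sampled on a fine grid, and points of \<open>S\<close> within
  \<open>r\<close> of the grid points form rows of chains, each \<open>3 r\<close>-homotopic to the next
  (\<open>chain_of_homotopic_path\<close>).

  If \<open>S\<close> is weakly chained, a loop close to \<open>S\<close> is homotopic to the polygon of a chain with small
  steps, and each step may be replaced by a homotopic chain with arbitrarily small steps; the new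
  polygon lies as close to \<open>S\<close> as desired (\<open>movable_if_weakly_chained\<close>).

  If \<open>S\<close> is connected and movable, two close points \<open>x\<close> and \<open>y\<close> of \<open>S\<close> are joined by a straight edge
  near \<open>S\<close>. The edge becomes a loop at the base point after adding paths from the base point to \<open>x\<close>
  and to \<open>y\<close>, which by connectedness can be taken as close to \<open>S\<close> as desired. Moving this loop close
  to \<open>S\<close> and cancelling the two added paths moves the edge itself with its endpoints fixed, and
  sampling that homotopy yields the chains that weak chaining asks for
  (\<open>weakly_chained_if_movable\<close>).

  An embedding of a compact space is a uniform homeomorphism onto its image, and weak chaining is
  invariant under those (\<open>weakly_chained_transfer\<close>); so the given metric may be exchanged for the
  metric of the cube. For compact sets, chain connected means connected.
\<close>

section \<open>Chains up to homotopy\<close>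

lemma eps_homotopic_sym:
  assumes "eps_homotopic M d \<epsilon> \<alpha> \<beta>"
  shows "eps_homotopic M d \<epsilon> \<beta> \<alpha>"
proof -
  have "symp (eps_move M d \<epsilon>)"
    by (auto simp: symp_def eps_move_def)
  then have "symp (eps_move M d \<epsilon>)\<^sup>*\<^sup>*"
    by (rule symp_rtranclp)
  then show ?thesis
    using assms by (auto simp: eps_homotopic_def dest: sympD)
qed

lemma eps_homotopic_trans:
  "eps_homotopic M d \<epsilon> \<alpha> \<beta> \<Longrightarrow> eps_homotopic M d \<epsilon> \<beta> \<gamma> \<Longrightarrow> eps_homotopic M d \<epsilon> \<alpha> \<gamma>"
  unfolding eps_homotopic_def by (meson rtranclp_trans)

lemma eps_homotopic_refl: "eps_chain M d \<epsilon> \<alpha> \<Longrightarrow> eps_homotopic M d \<epsilon> \<alpha> \<alpha>"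
  by (simp add: eps_homotopic_def)

lemma eps_class_eq_iff:
  assumes "eps_chain M d \<epsilon> \<alpha>"
  shows "eps_class M d \<epsilon> \<alpha> = eps_class M d \<epsilon> \<beta> \<longleftrightarrow> eps_homotopic M d \<epsilon> \<beta> \<alpha>"
proof
  assume "eps_class M d \<epsilon> \<alpha> = eps_class M d \<epsilon> \<beta>"
  moreover have "\<alpha> \<in> eps_class M d \<epsilon> \<alpha>"
    using assms by (simp add: eps_class_def eps_homotopic_refl)
  ultimately show "eps_homotopic M d \<epsilon> \<beta> \<alpha>"
    by (simp add: eps_class_def)
next
  assume "eps_homotopic M d \<epsilon> \<beta> \<alpha>"
  then show "eps_class M d \<epsilon> \<alpha> = eps_class M d \<epsilon> \<beta>"
    unfolding eps_class_def by (blast intro: eps_homotopic_sym eps_homotopic_trans)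
qed

text \<open>If \<open>[x, y]\<close> fails to be an \<open>\<epsilon>\<close>-chain, its class is empty and so different from the class of
  the chain \<open>\<alpha>\<close>. Hence equality of classes can be read as homotopy without any side condition.\<close>
lemma weakly_chained_iff:
  "weakly_chained M d \<longleftrightarrow>
     chain_connected M d \<and>
     (\<forall>\<epsilon>>0. \<exists>\<delta>>0. \<forall>x\<in>M. \<forall>y\<in>M. d x y < \<delta> \<longrightarrow>
        (\<forall>\<tau>>0. \<exists>\<alpha>. eps_chain_from_to M d \<tau> x y \<alpha> \<and> eps_homotopic M d \<epsilon> [x, y] \<alpha>))"
proof -
  have "eps_chain M d \<epsilon> \<alpha> \<and> eps_class M d \<epsilon> \<alpha> = eps_class M d \<epsilon> [x, y]
        \<longleftrightarrow> eps_homotopic M d \<epsilon> [x, y] \<alpha>" for \<epsilon> \<alpha> x y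
    using eps_class_eq_iff eps_homotopic_def by metis
  then show ?thesis
    unfolding weakly_chained_def by simp
qed

lemma eps_homotopic_insert:
  assumes "eps_chain M d \<epsilon> (us @ vs)" "eps_chain M d \<epsilon> (us @ p # vs)" "us \<noteq> []" "vs \<noteq> []"
  shows "eps_homotopic M d \<epsilon> (us @ vs) (us @ p # vs)"
proof -
  have "eps_move M d \<epsilon> (us @ vs) (us @ p # vs)"
    using assms unfolding eps_move_def eps_insertion_def by blast
  then show ?thesis
    using assms by (simp add: eps_homotopic_def r_into_rtranclp)
qed

lemma successively_map_upt:
  "successively P (map f [a..<b]) \<longleftrightarrow> (\<forall>i. a \<le> i \<and> Suc i < b \<longrightarrow> P (f i) (f (Suc i)))"
proof -
  have "successively P (map f [a..<b]) \<longleftrightarrow> (\<forall>i. Suc i < b - a \<longrightarrow> P (f (a + i)) (f (Suc (a + i))))"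
    by (auto simp: successively_conv_nth)
  also have "\<dots> \<longleftrightarrow> (\<forall>i. a \<le> i \<and> Suc i < b \<longrightarrow> P (f i) (f (Suc i)))"
  proof (intro iffI allI impI)
    fix i
    assume *: "\<forall>i. Suc i < b - a \<longrightarrow> P (f (a + i)) (f (Suc (a + i)))" and i: "a \<le> i \<and> Suc i < b"
    have "Suc (i - a) < b - a" "a + (i - a) = i"
      using i by auto
    then show "P (f i) (f (Suc i))"
      using * by force
  qed auto
  finally show ?thesis .
qed

lemma eps_chain_map_upt:
  assumes "\<And>j. j \<le> n \<Longrightarrow> x j \<in> M" "\<And>j. j < n \<Longrightarrow> d (x j) (x (Suc j)) < \<epsilon>"
  shows "eps_chain_from_to M d \<epsilon> (x 0) (x n) (map x [0..<Suc n])"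
proof -
  have "hd (map x [0..<Suc n]) = x 0"
    by (simp add: hd_map del: upt_Suc)
  moreover have "last (map x [0..<Suc n]) = x n"
    by simp
  ultimately show ?thesis
    using assms unfolding eps_chain_from_to_def eps_chain_def successively_map_upt by auto
qed

text \<open>The points \<open>x k\<close> are replaced by the points \<open>y k\<close> one after the other. The intermediate
  chains follow \<open>y\<close> up to some index and then cross over to \<open>x\<close>; the crossing is moved on by
  inserting \<open>y (Suc k)\<close> behind \<open>x k\<close> and then deleting \<open>x k\<close>, so only one of the two diagonals of
  each square has to be short.\<close>
lemma eps_homotopic_ladder:
  assumes xM: "\<And>j. j \<le> n \<Longrightarrow> x j \<in> M" and yM: "\<And>j. j \<le> n \<Longrightarrow> y j \<in> M"
    and xx: "\<And>j. j < n \<Longrightarrow> d (x j) (x (Suc j)) < \<epsilon>"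
    and yy: "\<And>j. j < n \<Longrightarrow> d (y j) (y (Suc j)) < \<epsilon>"
    and xy: "\<And>j. j < n \<Longrightarrow> d (x j) (y (Suc j)) < \<epsilon>"
    and yx: "\<And>j. j \<le> n \<Longrightarrow> d (y j) (x j) < \<epsilon>"
    and ends: "x 0 = y 0" "x n = y n"
  shows "eps_homotopic M d \<epsilon> (map x [0..<Suc n]) (map y [0..<Suc n])"
proof (cases "n = 0")
  case True
  then show ?thesis
    using xM ends by (auto simp: eps_homotopic_def eps_chain_def)
next
  case False
  let ?A = "\<lambda>k. map y [0..<Suc k]" and ?B = "\<lambda>k. map x [k..<Suc n]"
  have hdB: "hd (?B k) = x k" "?B k \<noteq> []" if "k \<le> n" for k
    using that by (simp_all add: hd_map del: upt_Suc)
  have lastA: "last (?A k) = y k" "?A k \<noteq> []" for k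
    by simp_all
  have BS: "?B k = x k # ?B (Suc k)" if "k \<le> n" for k
    using that by (simp add: upt_conv_Cons del: upt_Suc)
  have AS: "?A (Suc k) = ?A k @ [y (Suc k)]" for k
    by simp
  have chA: "eps_chain M d \<epsilon> (?A k)" if "k \<le> n" for k
    using that yM yy by (auto simp: eps_chain_def successively_map_upt simp del: upt_Suc)
  have chB: "eps_chain M d \<epsilon> (?B k)" if "k \<le> n" for k
    using that xM xx by (auto simp: eps_chain_def successively_map_upt simp del: upt_Suc)
  have chain_append: "eps_chain M d \<epsilon> (us @ vs)"
    if "eps_chain M d \<epsilon> us" "eps_chain M d \<epsilon> vs" "d (last us) (hd vs) < \<epsilon>" for us vs
    using that by (auto simp: eps_chain_def successively_append_iff)
  have chAB: "eps_chain M d \<epsilon> (?A k @ ?B k)" if "k \<le> n" for k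
    using chA chB chain_append hdB lastA that yx by metis
  have step: "eps_homotopic M d \<epsilon> (?A k @ ?B k) (?A (Suc k) @ ?B (Suc k))" if k: "k < n" for k
  proof -
    let ?D = "?A k @ x k # y (Suc k) # ?B (Suc k)"
    have "eps_chain M d \<epsilon> (y (Suc k) # ?B (Suc k))"
      using chain_append[of "[y (Suc k)]" "?B (Suc k)"] chB[of "Suc k"] hdB[of "Suc k"]
        yM[of "Suc k"] yx[of "Suc k"] k by (simp add: eps_chain_def del: upt_Suc)
    then have "eps_chain M d \<epsilon> (x k # y (Suc k) # ?B (Suc k))"
      using chain_append[of "[x k]" "y (Suc k) # ?B (Suc k)"] xM[of k] xy[of k] k
      by (simp add: eps_chain_def del: upt_Suc)
    then have chD: "eps_chain M d \<epsilon> ?D"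
      using chain_append[of "?A k"] chA[of k] lastA yx[of k] k by (simp del: upt_Suc)
    have "eps_homotopic M d \<epsilon> (?A k @ ?B k) ?D"
      using eps_homotopic_insert[of M d \<epsilon> "?A k @ [x k]" "?B (Suc k)" "y (Suc k)"]
        chAB[of k] chD BS[of k] hdB[of "Suc k"] k by (simp del: upt_Suc)
    moreover have "eps_homotopic M d \<epsilon> (?A (Suc k) @ ?B (Suc k)) ?D"
      using eps_homotopic_insert[of M d \<epsilon> "?A k" "y (Suc k) # ?B (Suc k)" "x k"]
        chAB[of "Suc k"] chD AS[of k] k by (simp del: upt_Suc)
    ultimately show ?thesis
      using eps_homotopic_sym eps_homotopic_trans by blast
  qed
  have "eps_homotopic M d \<epsilon> (?A 0 @ ?B 0) (?A k @ ?B k)" if "k \<le> n" for k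
    using that
  proof (induction k)
    case 0
    then show ?case using chAB eps_homotopic_refl by blast
  next
    case (Suc k)
    then show ?case using step eps_homotopic_trans by (meson Suc_le_lessD Suc_leD)
  qed
  then have "eps_homotopic M d \<epsilon> (?A 0 @ ?B 0) (?A n @ ?B n)"
    by blast
  \<comment> \<open>The common endpoints occur twice in the first and the last of these chains.\<close>
  moreover have "eps_homotopic M d \<epsilon> (?B 0) (?A 0 @ ?B 0)"
    using eps_homotopic_insert[of M d \<epsilon> "[x 0]" "?B 1" "x 0"] chB[of 0] chAB[of 0] BS[of 0]
      hdB[of 1] ends False by (simp del: upt_Suc add: upt_Suc[of 0 0])
  moreover have "eps_homotopic M d \<epsilon> (?A n) (?A n @ ?B n)"
    using eps_homotopic_insert[of M d \<epsilon> "map y [0..<n]" "[y n]" "y n"] chA[of n] chAB[of n]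
      ends False by simp
  ultimately show ?thesis
    using eps_homotopic_sym eps_homotopic_trans by blast
qed

lemma eps_homotopic_repeat_start:
  assumes "x \<in> M" "y \<in> M" "d x x < \<epsilon>" "d x y < \<epsilon>"
  shows "eps_homotopic M d \<epsilon> [x, y] (replicate (Suc n) x @ [y])"
proof (induction n)
  case 0
  then show ?case using assms by (simp add: eps_homotopic_def eps_chain_def)
next
  case (Suc n)
  have ch: "eps_chain M d \<epsilon> (replicate (Suc m) x @ [y])" for m
    using assms by (induction m) (auto simp: eps_chain_def)
  have "eps_homotopic M d \<epsilon> ([x] @ replicate n x @ [y]) ([x] @ x # replicate n x @ [y])"
    using ch[of n] ch[of "Suc n"] by (intro eps_homotopic_insert) auto
  then have "eps_homotopic M d \<epsilon> (replicate (Suc n) x @ [y]) (replicate (Suc (Suc n)) x @ [y])"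
    by simp
  with Suc show ?case
    by (rule eps_homotopic_trans)
qed

section \<open>Uniform homeomorphisms\<close>

lemma eps_chain_map:
  assumes "f ` M \<subseteq> M'" "\<And>x y. x \<in> M \<Longrightarrow> y \<in> M \<Longrightarrow> d x y < \<epsilon> \<Longrightarrow> d' (f x) (f y) < \<epsilon>'"
    and "eps_chain M d \<epsilon> xs"
  shows "eps_chain M' d' \<epsilon>' (map f xs)"
proof -
  have "successively (\<lambda>x y. d' (f x) (f y) < \<epsilon>') xs"
    using assms(3) unfolding eps_chain_def
    by (auto intro: successively_mono assms(2))
  then show ?thesis
    using assms(1,3) by (auto simp: eps_chain_def successively_map)
qed

lemma eps_homotopic_map:
  assumes "f ` M \<subseteq> M'" "\<And>x y. x \<in> M \<Longrightarrow> y \<in> M \<Longrightarrow> d x y < \<epsilon> \<Longrightarrow> d' (f x) (f y) < \<epsilon>'"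
    and "eps_homotopic M d \<epsilon> \<alpha> \<beta>"
  shows "eps_homotopic M' d' \<epsilon>' (map f \<alpha>) (map f \<beta>)"
proof -
  have ch: "eps_chain M' d' \<epsilon>' (map f xs)" if "eps_chain M d \<epsilon> xs" for xs
    by (rule eps_chain_map[of f M M' d \<epsilon> d' \<epsilon>' xs, OF assms(1,2) that])
  have ins': "eps_insertion M' d' \<epsilon>' (map f \<gamma>) (map f \<gamma>')" if ins: "eps_insertion M d \<epsilon> \<gamma> \<gamma>'" for \<gamma> \<gamma>'
  proof -
    obtain us p vs where *: "us \<noteq> []" "vs \<noteq> []" "\<gamma> = us @ vs" "\<gamma>' = us @ p # vs"
      and "eps_chain M d \<epsilon> \<gamma>" "eps_chain M d \<epsilon> \<gamma>'"
      using ins unfolding eps_insertion_def by blast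
    moreover have "map f us \<noteq> []" "map f vs \<noteq> []"
      "map f \<gamma> = map f us @ map f vs" "map f \<gamma>' = map f us @ f p # map f vs"
      using * by simp_all
    ultimately show ?thesis
      unfolding eps_insertion_def using ch by blast
  qed
  have mv: "eps_move M' d' \<epsilon>' (map f \<gamma>) (map f \<gamma>')" if "eps_move M d \<epsilon> \<gamma> \<gamma>'" for \<gamma> \<gamma>'
    using that ins' unfolding eps_move_def by blast
  have "(eps_move M d \<epsilon>)\<^sup>*\<^sup>* \<alpha> \<beta>"
    using assms(3) by (simp add: eps_homotopic_def)
  then have "(eps_move M' d' \<epsilon>')\<^sup>*\<^sup>* (map f \<alpha>) (map f \<beta>)"
    by induction (auto intro: rtranclp.rtrancl_into_rtrancl mv)
  then show ?thesis
    using assms(3) ch by (auto simp: eps_homotopic_def)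
qed

lemma eps_chain_from_to_map:
  assumes "f ` M \<subseteq> M'" "\<And>x y. x \<in> M \<Longrightarrow> y \<in> M \<Longrightarrow> d x y < \<epsilon> \<Longrightarrow> d' (f x) (f y) < \<epsilon>'"
    and "eps_chain_from_to M d \<epsilon> x y xs"
  shows "eps_chain_from_to M' d' \<epsilon>' (f x) (f y) (map f xs)"
proof -
  have "eps_chain M d \<epsilon> xs" "xs \<noteq> []" "hd xs = x" "last xs = y"
    using assms(3) by (auto simp: eps_chain_from_to_def eps_chain_def)
  moreover have "eps_chain M' d' \<epsilon>' (map f xs)" if "eps_chain M d \<epsilon> xs"
    by (rule eps_chain_map[of f M M' d \<epsilon> d' \<epsilon>' xs, OF assms(1,2) that])
  ultimately show ?thesis
    by (simp add: eps_chain_from_to_def hd_map last_map)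
qed

text \<open>Uniform continuity of \<open>f\<close> carries chains and their homotopies over to \<open>M'\<close>, while that of \<open>g\<close>
  turns the \<open>\<delta>\<close> that is found in \<open>M\<close> into one for \<open>M'\<close>.\<close>
lemma weakly_chained_transfer:
  assumes wc: "weakly_chained M d"
    and f: "f ` M \<subseteq> M'" and g: "g ` M' \<subseteq> M" and fg: "\<And>x. x \<in> M' \<Longrightarrow> f (g x) = x"
    and ucf: "\<And>\<epsilon>. \<epsilon> > 0 \<Longrightarrow> \<exists>\<delta>>0. \<forall>x\<in>M. \<forall>y\<in>M. d x y < \<delta> \<longrightarrow> d' (f x) (f y) < \<epsilon>"
    and ucg: "\<And>\<epsilon>. \<epsilon> > 0 \<Longrightarrow> \<exists>\<delta>>0. \<forall>x\<in>M'. \<forall>y\<in>M'. d' x y < \<delta> \<longrightarrow> d (g x) (g y) < \<epsilon>"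
  shows "weakly_chained M' d'"
  unfolding weakly_chained_iff chain_connected_def
proof (intro conjI ballI allI impI)
  fix x y and \<epsilon> :: real
  assume xy: "x \<in> M'" "y \<in> M'" and "\<epsilon> > 0"
  obtain \<epsilon>1 where \<epsilon>1: "\<epsilon>1 > 0" "\<And>u v. u \<in> M \<Longrightarrow> v \<in> M \<Longrightarrow> d u v < \<epsilon>1 \<Longrightarrow> d' (f u) (f v) < \<epsilon>"
    using ucf[OF \<open>\<epsilon> > 0\<close>] by blast
  have "g x \<in> M" "g y \<in> M"
    using g xy by auto
  then obtain \<alpha> where "eps_chain_from_to M d \<epsilon>1 (g x) (g y) \<alpha>"
    using wc \<epsilon>1(1) unfolding weakly_chained_iff chain_connected_def by blast
  then have "eps_chain_from_to M' d' \<epsilon> (f (g x)) (f (g y)) (map f \<alpha>)"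
    using eps_chain_from_to_map[of f M M' d \<epsilon>1 d' \<epsilon>, OF f \<epsilon>1(2)] by blast
  then show "\<exists>\<alpha>. eps_chain_from_to M' d' \<epsilon> x y \<alpha>"
    using fg xy by auto
next
  fix \<epsilon> :: real
  assume "\<epsilon> > 0"
  obtain \<epsilon>1 where \<epsilon>1: "\<epsilon>1 > 0" "\<And>u v. u \<in> M \<Longrightarrow> v \<in> M \<Longrightarrow> d u v < \<epsilon>1 \<Longrightarrow> d' (f u) (f v) < \<epsilon>"
    using ucf[OF \<open>\<epsilon> > 0\<close>] by blast
  obtain \<delta>1 where \<delta>1: "\<delta>1 > 0"
    "\<And>u v \<tau>. u \<in> M \<Longrightarrow> v \<in> M \<Longrightarrow> d u v < \<delta>1 \<Longrightarrow> \<tau> > 0 \<Longrightarrow>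
       \<exists>\<alpha>. eps_chain_from_to M d \<tau> u v \<alpha> \<and> eps_homotopic M d \<epsilon>1 [u, v] \<alpha>"
    using wc \<epsilon>1(1) unfolding weakly_chained_iff by metis
  obtain \<delta> where \<delta>: "\<delta> > 0" "\<And>u v. u \<in> M' \<Longrightarrow> v \<in> M' \<Longrightarrow> d' u v < \<delta> \<Longrightarrow> d (g u) (g v) < \<delta>1"
    using ucg[OF \<open>\<delta>1 > 0\<close>] by blast
  have "\<exists>\<alpha>. eps_chain_from_to M' d' \<tau> x y \<alpha> \<and> eps_homotopic M' d' \<epsilon> [x, y] \<alpha>"
    if xy: "x \<in> M'" "y \<in> M'" "d' x y < \<delta>" and "\<tau> > 0" for x y \<tau>
  proof -
    obtain \<tau>1 where \<tau>1: "\<tau>1 > 0" "\<And>u v. u \<in> M \<Longrightarrow> v \<in> M \<Longrightarrow> d u v < \<tau>1 \<Longrightarrow> d' (f u) (f v) < \<tau>"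
      using ucf[OF \<open>\<tau> > 0\<close>] by blast
    have "g x \<in> M" "g y \<in> M"
      using g xy by auto
    then obtain \<alpha> where \<alpha>: "eps_chain_from_to M d \<tau>1 (g x) (g y) \<alpha>"
      "eps_homotopic M d \<epsilon>1 [g x, g y] \<alpha>"
      using \<delta>1(2) \<delta>(2) xy \<tau>1(1) by blast
    have "eps_chain_from_to M' d' \<tau> (f (g x)) (f (g y)) (map f \<alpha>)"
      using eps_chain_from_to_map[of f M M' d \<tau>1 d' \<tau>, OF f \<tau>1(2) \<alpha>(1)] by blast
    moreover have "eps_homotopic M' d' \<epsilon> (map f [g x, g y]) (map f \<alpha>)"
      using eps_homotopic_map[of f M M' d \<epsilon>1 d' \<epsilon>, OF f \<epsilon>1(2) \<alpha>(2)] by blast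
    ultimately show ?thesis
      using fg xy by auto
  qed
  then show "\<exists>\<delta>>0. \<forall>x\<in>M'. \<forall>y\<in>M'. d' x y < \<delta> \<longrightarrow>
      (\<forall>\<tau>>0. \<exists>\<alpha>. eps_chain_from_to M' d' \<tau> x y \<alpha> \<and> eps_homotopic M' d' \<epsilon> [x, y] \<alpha>)"
    using \<delta>(1) by blast
qed

section \<open>Chain connectedness and connectedness\<close>

lemma chain_connected_if_connected:
  fixes S :: "'a::metric_space set"
  assumes "connected S"
  shows "chain_connected S dist"
  unfolding chain_connected_def
proof (intro ballI allI impI)
  fix x y and \<epsilon> :: real
  assume xy: "x \<in> S" "y \<in> S" and "\<epsilon> > 0"
  let ?R = "\<lambda>x y. \<exists>\<alpha>. eps_chain_from_to S dist \<epsilon> x y \<alpha>"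
  show "?R x y"
  proof (rule connected_equivalence_relation[OF assms xy])
    show "?R v u" if uv: "?R u v" for u v
    proof -
      obtain \<alpha> where "eps_chain_from_to S dist \<epsilon> u v \<alpha>"
        using uv by blast
      then have "eps_chain_from_to S dist \<epsilon> v u (rev \<alpha>)"
        by (simp add: eps_chain_from_to_def eps_chain_def hd_rev last_rev dist_commute
            successively_rev)
      then show ?thesis by blast
    qed
    show "?R u w" if uv: "?R u v" and vw: "?R v w" for u v w
    proof -
      obtain \<alpha> \<beta> where "eps_chain_from_to S dist \<epsilon> u v \<alpha>" "eps_chain_from_to S dist \<epsilon> v w \<beta>"
        using uv vw by blast
      then have "eps_chain_from_to S dist \<epsilon> u w (\<alpha> @ \<beta>)"
        using \<open>\<epsilon> > 0\<close>
        by (auto simp: eps_chain_from_to_def eps_chain_def successively_append_iff)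
      then show ?thesis by blast
    qed
    show "\<exists>T. openin (top_of_set S) T \<and> u \<in> T \<and> (\<forall>v\<in>T. ?R u v)" if "u \<in> S" for u
    proof (intro exI conjI ballI)
      show "openin (top_of_set S) (S \<inter> ball u \<epsilon>)"
        by (simp add: openin_open_Int)
      show "u \<in> S \<inter> ball u \<epsilon>"
        using that \<open>\<epsilon> > 0\<close> by simp
      show "eps_chain_from_to S dist \<epsilon> u v [u, v]" if "v \<in> S \<inter> ball u \<epsilon>" for v
        using that \<open>u \<in> S\<close> by (simp add: eps_chain_from_to_def eps_chain_def)
    qed
  qed
qed

text \<open>In a disconnected compact set, two clopen parts have a positive distance \<open>\<delta>\<close>, and a \<open>\<delta>\<close>-chain
  cannot pass from one to the other.\<close>
lemma connected_if_chain_connected: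
  fixes S :: "'a::metric_space set"
  assumes "chain_connected S dist" "compact S"
  shows "connected S"
proof (rule ccontr)
  assume "\<not> connected S"
  then obtain A B where AB: "closedin (top_of_set S) A" "closedin (top_of_set S) B"
      "A \<union> B = S" "A \<inter> B = {}" "A \<noteq> {}" "B \<noteq> {}"
    by (auto simp: connected_closedin_eq)
  then have "compact A" "compact B"
    using assms(2) closedin_compact by blast+
  then have "closed B"
    using compact_imp_closed by blast
  moreover have "A \<subseteq> - B"
    using AB(4) by blast
  ultimately obtain \<delta> where \<delta>: "\<delta> > 0" "(\<Union>a\<in>A. ball a \<delta>) \<subseteq> - B"
    using compact_subset_open_imp_ball_epsilon_subset[of A "- B"] \<open>compact A\<close> by (auto simp: open_Compl)
  have stay: "last xs \<in> A" if "eps_chain S dist \<delta> xs" "hd xs \<in> A" for xs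
    using that
  proof (induction xs)
    case (Cons u us)
    show ?case
    proof (cases us)
      case Nil
      then show ?thesis using Cons.prems by simp
    next
      case (Cons v vs)
      have "eps_chain S dist \<delta> us" "v \<in> S" "dist u v < \<delta>" "u \<in> A"
        using Cons.prems local.Cons by (auto simp: eps_chain_def)
      then show ?thesis
        using Cons.IH \<delta>(2) AB(3) local.Cons by fastforce
    qed
  qed (simp add: eps_chain_def)
  obtain a b where "a \<in> A" "b \<in> B"
    using AB by blast
  then obtain xs where "eps_chain_from_to S dist \<delta> a b xs"
    using assms(1) AB(3) \<delta>(1) unfolding chain_connected_def by blast
  then show False
    using stay \<open>a \<in> A\<close> \<open>b \<in> B\<close> AB(4) by (auto simp: eps_chain_from_to_def)
qed

section \<open>Paths in the Hilbert cube\<close>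

text \<open>Reassociating, cancelling and subdividing paths all amount to running through one fixed
  path \<open>p\<close> along two different paths of parameters, which are homotopic because an interval is
  convex.\<close>
lemma homotopic_paths_reparametrized:
  fixes p :: "real \<Rightarrow> 'a::topological_space"
  assumes p: "path p" "path_image p \<subseteq> U"
    and \<phi>: "path \<phi>" "path_image \<phi> \<subseteq> {0..1}" and \<psi>: "path \<psi>" "path_image \<psi> \<subseteq> {0..1}"
    and ends: "pathstart \<phi> = pathstart \<psi>" "pathfinish \<phi> = pathfinish \<psi>"
  shows "homotopic_paths U (p \<circ> \<phi>) (p \<circ> \<psi>)"
proof (rule homotopic_paths_continuous_image)
  show "homotopic_paths {0..1} \<phi> \<psi>"
  proof (rule homotopic_paths_linear)
    fix t :: real
    assume "t \<in> {0..1}"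
    then have "\<phi> t \<in> {0..1}" "\<psi> t \<in> {0..1}"
      using \<phi>(2) \<psi>(2) unfolding path_image_def by blast+
    then show "closed_segment (\<phi> t) (\<psi> t) \<subseteq> {0..1}"
      by (simp add: closed_segment_subset)
  qed (use \<phi> \<psi> ends in auto)
  show "continuous_on {0..1} p"
    using p(1) by (simp add: path_def)
  show "p \<in> {0..1} \<rightarrow> U"
    using p(2) by (auto simp: path_image_def)
qed

definition straight_path :: "(nat \<Rightarrow> real) \<Rightarrow> (nat \<Rightarrow> real) \<Rightarrow> real \<Rightarrow> nat \<Rightarrow> real" where
  "straight_path x y t = (\<lambda>n. (1 - t) * x n + t * y n)"

definition coord_convex :: "(nat \<Rightarrow> real) set \<Rightarrow> bool" where
  "coord_convex C \<longleftrightarrow> (\<forall>x\<in>C. \<forall>y\<in>C. path_image (straight_path x y) \<subseteq> C)"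

lemma straight_path_ends [simp]:
  "pathstart (straight_path x y) = x" "pathfinish (straight_path x y) = y"
  by (simp_all add: straight_path_def pathstart_def pathfinish_def)

lemma path_image_straight_path_refl [simp]: "path_image (straight_path x x) = {x}"
  by (auto simp: straight_path_def path_image_def algebra_simps image_constant_conv)

lemma coord_convexD:
  "coord_convex C \<Longrightarrow> x \<in> C \<Longrightarrow> y \<in> C \<Longrightarrow> path_image (straight_path x y) \<subseteq> C"
  by (simp add: coord_convex_def)

lemma path_straight_path [simp]: "path (straight_path x y)"
  unfolding path_def straight_path_def
  by (intro continuous_on_coordinatewise_then_product continuous_intros)

lemma homotopic_paths_coord_convex:
  assumes C: "coord_convex C"
    and g: "path g" "path_image g \<subseteq> C" and h: "path h" "path_image h \<subseteq> C"
    and ends: "pathstart g = pathstart h" "pathfinish g = pathfinish h"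
  shows "homotopic_paths C g h"
proof -
  let ?H = "\<lambda>z. straight_path (g (snd z)) (h (snd z)) (fst z)"
  have "continuous_on {0..1} (\<lambda>t. g t n)" "continuous_on {0..1} (\<lambda>t. h t n)" for n
    using g(1) h(1) unfolding path_def by (auto intro: continuous_on_product_then_coordinatewise)
  then have cont: "continuous_on ({0..1} \<times> {0..1}) (\<lambda>z. g (snd z) n)"
    "continuous_on ({0..1} \<times> {0..1}) (\<lambda>z. h (snd z) n)" for n
    by (auto intro!: continuous_on_compose2[of "{0..1}" _ _ snd] continuous_on_snd continuous_on_id)
  have "continuous_on ({0..1} \<times> {0..1}) ?H"
    unfolding straight_path_def
    by (intro continuous_on_coordinatewise_then_product continuous_intros cont)
  moreover have "?H \<in> {0..1} \<times> {0..1} \<rightarrow> C"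
  proof
    fix z :: "real \<times> real"
    assume z: "z \<in> {0..1} \<times> {0..1}"
    then have "g (snd z) \<in> C" "h (snd z) \<in> C"
      using g(2) h(2) by (auto simp: path_image_def)
    then have "path_image (straight_path (g (snd z)) (h (snd z))) \<subseteq> C"
      by (rule coord_convexD[OF C])
    moreover have "fst z \<in> {0..1}"
      using z by auto
    ultimately show "?H z \<in> C"
      by (auto simp: path_image_def image_subset_iff)
  qed
  ultimately show ?thesis
    unfolding homotopic_paths
  proof (intro exI[of _ ?H] conjI ballI)
    have refl: "straight_path x x t = x" for x t
      by (simp add: straight_path_def algebra_simps)
    show "pathstart (?H \<circ> Pair t) = pathstart g" "pathfinish (?H \<circ> Pair t) = pathfinish g" for t
      using ends by (simp_all add: pathstart_def pathfinish_def refl)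
  qed (simp_all add: straight_path_def)
qed

text \<open>The metric of the product space truncates the coordinate distances at \<open>1\<close>, but in the cube
  they never exceed \<open>1\<close>; there the metric is a convergent sum of convex functions.\<close>
lemma coord_convex_cube_ball:
  assumes x: "x \<in> hilbert_cube"
  shows "coord_convex (hilbert_cube \<inter> ball x \<epsilon>)"
  unfolding coord_convex_def
proof (intro ballI subsetI)
  fix y z w
  assume y: "y \<in> hilbert_cube \<inter> ball x \<epsilon>" and z: "z \<in> hilbert_cube \<inter> ball x \<epsilon>"
    and "w \<in> path_image (straight_path y z)"
  then obtain t where t: "0 \<le> t" "t \<le> 1" and w: "w = straight_path y z t"
    by (auto simp: path_image_def)
  have cube: "0 \<le> x n" "x n \<le> 1" "0 \<le> y n" "y n \<le> 1" "0 \<le> z n" "z n \<le> 1" for n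
    using x y z by (auto simp: hilbert_cube_def)
  have wn: "0 \<le> w n \<and> w n \<le> 1" for n
    using cube[of n] t convex_bound_le[of "y n" 1 "z n" "1 - t" t]
    by (auto simp: w straight_path_def)
  let ?D = "\<lambda>u n. (1/2)^n * min (dist (x (from_nat n)) (u (from_nat n))) (1::real)"
  have sm: "summable (?D u)" for u
    by (rule summable_comparison_test'[of "\<lambda>n. (1/2)^n"]) (auto simp: summable_geometric_iff)
  have le: "?D w n \<le> (1 - t) * ?D y n + t * ?D z n" for n
  proof -
    let ?m = "from_nat n :: nat"
    have le1: "\<bar>x ?m - y ?m\<bar> \<le> 1" "\<bar>x ?m - z ?m\<bar> \<le> 1" "\<bar>x ?m - w ?m\<bar> \<le> 1"
      using cube[of ?m] wn[of ?m] by auto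
    have "x ?m - w ?m = (1 - t) * (x ?m - y ?m) + t * (x ?m - z ?m)"
      by (simp add: w straight_path_def algebra_simps)
    then have "\<bar>x ?m - w ?m\<bar> \<le> \<bar>(1 - t) * (x ?m - y ?m)\<bar> + \<bar>t * (x ?m - z ?m)\<bar>"
      by linarith
    then have "\<bar>x ?m - w ?m\<bar> \<le> (1 - t) * \<bar>x ?m - y ?m\<bar> + t * \<bar>x ?m - z ?m\<bar>"
      using t by (simp add: abs_mult)
    then have "(1/2)^n * \<bar>x ?m - w ?m\<bar> \<le> (1/2)^n * ((1 - t) * \<bar>x ?m - y ?m\<bar> + t * \<bar>x ?m - z ?m\<bar>)"
      by (intro mult_left_mono) auto
    then show ?thesis
      using le1 by (simp add: dist_real_def algebra_simps)
  qed
  have "dist x w \<le> (\<Sum>n. (1 - t) * ?D y n + t * ?D z n)"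
    unfolding dist_fun_def by (intro suminf_le le summable_add summable_mult sm)
  also have "\<dots> = (1 - t) * dist x y + t * dist x z"
    unfolding dist_fun_def by (simp add: suminf_add[symmetric] suminf_mult sm summable_mult)
  also have "\<dots> < \<epsilon>"
    using y z t convex_bound_lt[of "dist x y" \<epsilon> "dist x z" "1 - t" t] by simp
  finally show "w \<in> hilbert_cube \<inter> ball x \<epsilon>"
    using wn by (simp add: hilbert_cube_def)
qed

lemma straight_path_in_cube_ball:
  assumes "x \<in> hilbert_cube" "y \<in> hilbert_cube" "dist x y < \<epsilon>"
  shows "path_image (straight_path x y) \<subseteq> hilbert_cube \<inter> ball x \<epsilon>"
proof -
  have "\<epsilon> > 0"
    using assms(3) zero_le_dist[of x y] by linarith
  then show ?thesis
    using coord_convexD[OF coord_convex_cube_ball] assms by simp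
qed

text \<open>By compactness these metric neighbourhoods are cofinal among all neighbourhoods of \<open>S\<close> in the
  cube, so movability can be tested on them.\<close>
definition tube :: "(nat \<Rightarrow> real) set \<Rightarrow> real \<Rightarrow> (nat \<Rightarrow> real) set" where
  "tube S \<epsilon> = hilbert_cube \<inter> (\<Union>s\<in>S. ball s \<epsilon>)"

lemma tube_mono: "\<delta> \<le> \<epsilon> \<Longrightarrow> tube S \<delta> \<subseteq> tube S \<epsilon>"
  by (auto simp: tube_def)

lemma cube_ball_subset_tube: "x \<in> S \<Longrightarrow> hilbert_cube \<inter> ball x \<epsilon> \<subseteq> tube S \<epsilon>"
  by (auto simp: tube_def)

lemma subset_tube: "S \<subseteq> hilbert_cube \<Longrightarrow> \<epsilon> > 0 \<Longrightarrow> S \<subseteq> tube S \<epsilon>"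
  by (force simp: tube_def)

lemma cube_nbhd_tube:
  assumes "S \<subseteq> hilbert_cube" "\<epsilon> > 0"
  shows "cube_nbhd S (tube S \<epsilon>)"
proof -
  have "openin (top_of_set hilbert_cube) (tube S \<epsilon>)"
    unfolding tube_def by (intro openin_open_Int open_UN) auto
  then show ?thesis
    using subset_tube[OF assms] by (auto simp: cube_nbhd_def tube_def)
qed

lemma cube_nbhd_contains_tube:
  assumes "cube_nbhd S U" "compact S"
  obtains \<epsilon> where "\<epsilon> > 0" "tube S \<epsilon> \<subseteq> U"
proof -
  obtain T where T: "open T" "S \<subseteq> hilbert_cube \<inter> T" "hilbert_cube \<inter> T \<subseteq> U"
    using assms(1) unfolding cube_nbhd_def openin_open by blast
  obtain \<epsilon> where "\<epsilon> > 0" "(\<Union>x\<in>S. ball x \<epsilon>) \<subseteq> T"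
    using compact_subset_open_imp_ball_epsilon_subset[OF assms(2) T(1)] T(2) by blast
  then have "tube S \<epsilon> \<subseteq> U"
    using T(3) unfolding tube_def by blast
  with \<open>\<epsilon> > 0\<close> show thesis
    by (rule that)
qed

section \<open>Polygonal paths of chains\<close>

text \<open>The constant edge at the last vertex lets two polygons be joined, and a vertex be inserted,
  without treating the last vertex separately.\<close>
fun polygon :: "(nat \<Rightarrow> real) list \<Rightarrow> real \<Rightarrow> nat \<Rightarrow> real" where
  "polygon [] = undefined"
| "polygon [x] = straight_path x x"
| "polygon (x # y # zs) = straight_path x y +++ polygon (y # zs)"

lemma polygon_ends [simp]:
  "xs \<noteq> [] \<Longrightarrow> pathstart (polygon xs) = hd xs"
  "xs \<noteq> [] \<Longrightarrow> pathfinish (polygon xs) = last xs"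
  by (induction xs rule: polygon.induct) simp_all

lemma path_polygon [simp]: "xs \<noteq> [] \<Longrightarrow> path (polygon xs)"
  by (induction xs rule: polygon.induct) (auto intro!: path_join_imp)

lemma polygon_in_coord_convex:
  assumes "coord_convex C" "xs \<noteq> []" "set xs \<subseteq> C"
  shows "path_image (polygon xs) \<subseteq> C"
  using assms(2,3)
proof (induction xs rule: polygon.induct)
  case (3 x y zs)
  then show ?case
    using coord_convexD[OF assms(1), of x y] by (simp add: path_image_join)
qed simp_all

lemma polygon_in_tube:
  assumes S: "S \<subseteq> hilbert_cube" and "\<epsilon> > 0" and "eps_chain S dist \<epsilon> xs"
  shows "path_image (polygon xs) \<subseteq> tube S \<epsilon>"
  using assms(3)
proof (induction xs rule: polygon.induct)
  case (2 x)
  then show ?case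
    using subset_tube[OF S \<open>\<epsilon> > 0\<close>] by (auto simp: eps_chain_def)
next
  case (3 x y zs)
  then have *: "x \<in> S" "y \<in> S" "dist x y < \<epsilon>" "eps_chain S dist \<epsilon> (y # zs)"
    by (auto simp: eps_chain_def)
  then have "path_image (straight_path x y) \<subseteq> hilbert_cube \<inter> ball x \<epsilon>"
    using straight_path_in_cube_ball S by blast
  then show ?case
    using 3 * cube_ball_subset_tube[of x S \<epsilon>] by (auto simp: path_image_join)
qed (simp add: eps_chain_def)

text \<open>An inserted point \<open>p\<close> and its two neighbours lie in the ball around \<open>p\<close>, where the edge
  that is replaced can be deformed into the two new edges.\<close>
lemma homotopic_polygon_insert:
  assumes S: "S \<subseteq> hilbert_cube" and \<epsilon>: "\<epsilon> > 0" and ne: "us \<noteq> []" "vs \<noteq> []"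
    and ch: "eps_chain S dist \<epsilon> (us @ vs)" "eps_chain S dist \<epsilon> (us @ p # vs)"
  shows "homotopic_paths (tube S \<epsilon>) (polygon (us @ vs)) (polygon (us @ p # vs))"
  using ne(1) ch
proof (induction us rule: polygon.induct)
  case (2 x)
  obtain y zs where vs: "vs = y # zs"
    using ne(2) by (cases vs) auto
  let ?C = "hilbert_cube \<inter> ball p \<epsilon>"
  have *: "x \<in> S" "p \<in> S" "y \<in> S" "dist x p < \<epsilon>" "dist p y < \<epsilon>" "eps_chain S dist \<epsilon> (y # zs)"
    using 2 vs by (auto simp: eps_chain_def)
  have C: "coord_convex ?C"
    using coord_convex_cube_ball * S by blast
  have xpy: "x \<in> ?C" "p \<in> ?C" "y \<in> ?C"
    using * S \<epsilon> by (auto simp: dist_commute)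
  have "homotopic_paths ?C (straight_path x y) (straight_path x p +++ straight_path p y)"
    by (intro homotopic_paths_coord_convex[OF C])
      (use coord_convexD[OF C] xpy in \<open>auto simp: path_image_join intro!: path_join_imp\<close>)
  then have edge: "homotopic_paths (tube S \<epsilon>) (straight_path x y) (straight_path x p +++ straight_path p y)"
    using cube_ball_subset_tube[OF \<open>p \<in> S\<close>] homotopic_paths_subset by blast
  have rest: "homotopic_paths (tube S \<epsilon>) (polygon (y # zs)) (polygon (y # zs))"
    using polygon_in_tube[OF S \<epsilon>] * by simp
  have im: "path_image (straight_path x p) \<subseteq> tube S \<epsilon>" "path_image (straight_path p y) \<subseteq> tube S \<epsilon>"
    using homotopic_paths_imp_subset[OF edge] by (auto simp: path_image_join)
  have "homotopic_paths (tube S \<epsilon>) (straight_path x y +++ polygon (y # zs))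
          ((straight_path x p +++ straight_path p y) +++ polygon (y # zs))"
    by (intro homotopic_paths_join edge rest) simp
  also have "homotopic_paths (tube S \<epsilon>) \<dots>
          (straight_path x p +++ (straight_path p y +++ polygon (y # zs)))"
    using rest im by (intro homotopic_paths_sym[OF homotopic_paths_assoc]) auto
  finally show ?case
    by (simp add: vs)
next
  case (3 x y zs)
  then have *: "x \<in> S" "y \<in> S" "dist x y < \<epsilon>" "eps_chain S dist \<epsilon> ((y # zs) @ vs)"
      "eps_chain S dist \<epsilon> ((y # zs) @ p # vs)"
    by (auto simp: eps_chain_def)
  then have "path_image (straight_path x y) \<subseteq> hilbert_cube \<inter> ball x \<epsilon>"
    using straight_path_in_cube_ball S by blast
  then have "homotopic_paths (tube S \<epsilon>) (straight_path x y) (straight_path x y)"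
    using cube_ball_subset_tube[OF \<open>x \<in> S\<close>] by auto
  then show ?case
    using 3 * by (auto intro!: homotopic_paths_join)
qed simp

lemma homotopic_polygon:
  assumes S: "S \<subseteq> hilbert_cube" and \<epsilon>: "\<epsilon> > 0" and "eps_homotopic S dist \<epsilon> \<alpha> \<beta>"
  shows "homotopic_paths (tube S \<epsilon>) (polygon \<alpha>) (polygon \<beta>)"
proof -
  have ins: "homotopic_paths (tube S \<epsilon>) (polygon \<gamma>) (polygon \<gamma>')"
    if "eps_insertion S dist \<epsilon> \<gamma> \<gamma>'" for \<gamma> \<gamma>'
    using that homotopic_polygon_insert[OF S \<epsilon>] by (auto simp: eps_insertion_def)
  have mv: "homotopic_paths (tube S \<epsilon>) (polygon \<gamma>) (polygon \<gamma>')"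
    if "eps_move S dist \<epsilon> \<gamma> \<gamma>'" for \<gamma> \<gamma>'
    using that ins homotopic_paths_sym unfolding eps_move_def by blast
  have \<alpha>: "eps_chain S dist \<epsilon> \<alpha>" and "(eps_move S dist \<epsilon>)\<^sup>*\<^sup>* \<alpha> \<beta>"
    using assms(3) by (auto simp: eps_homotopic_def)
  from this(2) show ?thesis
  proof induction
    case base
    then show ?case
      using polygon_in_tube[OF S \<epsilon> \<alpha>] \<alpha> by (simp add: eps_chain_def)
  next
    case (step \<gamma> \<gamma>')
    then show ?case
      using mv homotopic_paths_trans by blast
  qed
qed

section \<open>Weakly chained sets are movable\<close>

text \<open>Backward induction along the subdivision of \<open>g\<close>. The remaining part of \<open>g\<close> starts off \<open>S\<close>, so
  it is compared with a short edge to the sample point \<open>s j\<close> followed by a path \<open>h\<close> in \<open>W\<close>. One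
  step takes place in the ball around \<open>s j\<close>: there the next piece of \<open>g\<close> and the edge to
  \<open>s (Suc j)\<close> can be deformed into the edge to \<open>s j\<close> and the edge from \<open>s j\<close> to \<open>s (Suc j)\<close>; the latter
  is then replaced by a path in \<open>W\<close>.\<close>
lemma shrink_path_along_chain:
  fixes s :: "nat \<Rightarrow> nat \<Rightarrow> real"
  assumes S: "S \<subseteq> hilbert_cube" and W: "S \<subseteq> W" and r: "r > 0" "3 * r \<le> \<delta>" "\<delta> \<le> \<epsilon>"
    and step: "\<And>x y. x \<in> S \<Longrightarrow> y \<in> S \<Longrightarrow> dist x y < \<delta> \<Longrightarrow>
      \<exists>a. path_image a \<subseteq> W \<and> homotopic_paths (tube S \<epsilon>) (straight_path x y) a"
    and g: "path g" "path_image g \<subseteq> tube S r"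
    and N: "N > 0"
    and fine: "\<And>j t. j < N \<Longrightarrow> real j / real N \<le> t \<Longrightarrow> t \<le> real (Suc j) / real N \<Longrightarrow>
      dist (g (real j / real N)) (g t) < r"
    and s: "\<And>j. j \<le> N \<Longrightarrow> s j \<in> S" "\<And>j. j \<le> N \<Longrightarrow> dist (g (real j / real N)) (s j) < r"
      "s N = pathfinish g"
    and "j \<le> N"
  shows "\<exists>h. path h \<and> path_image h \<subseteq> W \<and> pathstart h = s j \<and> pathfinish h = s N \<and>
    homotopic_paths (tube S \<epsilon>) (g \<circ> linepath (real j / real N) 1)
      (straight_path (g (real j / real N)) (s j) +++ h)"
  using \<open>j \<le> N\<close>
proof (induction j rule: inc_induct)
  case base
  have gN: "g (real N / real N) = s N"
    using N s(3) by (simp add: pathfinish_def)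
  have const: "g \<circ> linepath (real N / real N) 1 = (\<lambda>t. s N)"
    using N gN by (auto simp: linepath_def)
  let ?c = "straight_path (s N) (s N)"
  let ?C = "hilbert_cube \<inter> ball (s N) \<epsilon>"
  have sN: "s N \<in> S" "s N \<in> ?C"
    using s(1)[of N] S r by auto
  have C: "coord_convex ?C"
    using coord_convex_cube_ball sN by blast
  have "homotopic_paths ?C (\<lambda>t. s N) (?c +++ ?c)"
    using sN
    by (intro homotopic_paths_coord_convex[OF C])
      (auto simp: path_image_join pathstart_def[of "\<lambda>_. _"] pathfinish_def[of "\<lambda>_. _"]
        path_image_def[of "\<lambda>_. _"] path_def[of "\<lambda>_. _"] intro!: path_join_imp)
  then have "homotopic_paths (tube S \<epsilon>) (\<lambda>t. s N) (?c +++ ?c)"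
    using cube_ball_subset_tube[OF sN(1)] homotopic_paths_subset by blast
  then show ?case
    using W sN(1) unfolding const gN by (intro exI[of _ ?c]) auto
next
  case (step n)
  define t where "t = real n / real N"
  define t' where "t' = real (Suc n) / real N"
  have tt': "0 \<le> t" "t \<le> t'" "t' \<le> 1"
    using step.hyps N by (auto simp: t_def t'_def divide_simps)
  let ?T = "tube S \<epsilon>" and ?C = "hilbert_cube \<inter> ball (s n) \<epsilon>"
  let ?A = "g \<circ> linepath t t'" and ?B = "straight_path (g t') (s (Suc n))"
    and ?D = "straight_path (g t) (s n)"
  obtain h where h: "path h" "path_image h \<subseteq> W" "pathstart h = s (Suc n)" "pathfinish h = s N"
    and hom: "homotopic_paths ?T (g \<circ> linepath t' 1) (?B +++ h)"
    using step.IH unfolding t'_def by blast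
  have sS: "s n \<in> S" "s (Suc n) \<in> S"
    using s(1) step.hyps by auto
  have near: "dist (g t) (s n) < r" "dist (g t') (s (Suc n)) < r"
    using s(2)[of n] s(2)[of "Suc n"] step.hyps by (simp_all add: t_def t'_def)
  have gu: "dist (g t) (g u) < r" if "t \<le> u" "u \<le> t'" for u
    using fine[of n u] that step.hyps by (simp add: t_def t'_def)
  have su: "dist (s n) (g u) < 2 * r" if "t \<le> u" "u \<le> t'" for u
    using dist_triangle[of "s n" "g u" "g t"] gu[OF that] near(1) by (simp add: dist_commute)
  have ss: "dist (s n) (s (Suc n)) < 3 * r"
    using dist_triangle[of "s n" "s (Suc n)" "g t'"] su[of t'] tt' near(2) by simp
  have gT: "path_image g \<subseteq> ?T"
    using g(2) tube_mono[of r \<epsilon> S] r by auto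
  have gQ: "g u \<in> hilbert_cube" if "0 \<le> u" "u \<le> 1" for u
    using g(2) that by (auto simp: path_image_def tube_def)
  have C: "coord_convex ?C"
    using coord_convex_cube_ball sS S by blast
  have in_C: "g u \<in> ?C" if "t \<le> u" "u \<le> t'" for u
    using su[OF that] gQ[of u] that tt' r by auto
  have s_in_C: "s n \<in> ?C" "s (Suc n) \<in> ?C"
    using sS S ss r by auto
  obtain a where a: "path_image a \<subseteq> W" "homotopic_paths ?T (straight_path (s n) (s (Suc n))) a"
    using assms(6)[OF sS] ss r by auto
  have a': "path a" "pathstart a = s n" "pathfinish a = s (Suc n)" "path_image a \<subseteq> ?T"
    using homotopic_paths_imp_path[OF a(2)] homotopic_paths_imp_pathstart[OF a(2)]
      homotopic_paths_imp_pathfinish[OF a(2)] homotopic_paths_imp_subset[OF a(2)] by auto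
  have lin: "path_image (linepath t t') = {t..t'}" "path_image (linepath t' 1) = {t'..1}"
      "path_image (linepath t 1) = {t..1}"
    using tt' by (simp_all add: closed_segment_eq_real_ivl)
  have pA: "path ?A"
  proof (rule path_continuous_image)
    show "continuous_on (path_image (linepath t t')) g"
      unfolding lin using g(1) tt' by (auto simp: path_def intro: continuous_on_subset)
  qed simp
  have iA: "path_image ?A \<subseteq> ?C"
    using in_C lin(1) by (auto simp: path_image_compose)
  have eA: "pathstart ?A = g t" "pathfinish ?A = g t'"
    by (simp_all add: pathstart_compose pathfinish_compose)
  have iB: "path_image ?B \<subseteq> ?C" and iD: "path_image ?D \<subseteq> ?C"
    and iE: "path_image (straight_path (s n) (s (Suc n))) \<subseteq> ?C"
    using coord_convexD[OF C] in_C[of t'] in_C[of t] s_in_C tt' by blast+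
  have CT: "?C \<subseteq> ?T"
    using cube_ball_subset_tube sS by blast
  have hT: "path_image h \<subseteq> ?T"
    using homotopic_paths_imp_subset[OF hom] h by (auto simp: path_image_join)
  have "homotopic_paths ?T (g \<circ> linepath t 1) (g \<circ> (linepath t t' +++ linepath t' 1))"
    using tt' by (intro homotopic_paths_reparametrized[OF g(1) gT])
      (auto simp: path_image_join closed_segment_eq_real_ivl)
  also have "g \<circ> (linepath t t' +++ linepath t' 1) = ?A +++ (g \<circ> linepath t' 1)"
    by (rule path_compose_join)
  also have "homotopic_paths ?T \<dots> (?A +++ (?B +++ h))"
    using pA iA CT eA by (intro homotopic_paths_join hom) (auto simp: pathstart_compose)
  also have "homotopic_paths ?T \<dots> ((?A +++ ?B) +++ h)"
    using pA iA iB CT eA h hT by (intro homotopic_paths_assoc) auto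
  also have "homotopic_paths ?T \<dots> ((?D +++ a) +++ h)"
  proof (rule homotopic_paths_join)
    have "homotopic_paths ?C (?A +++ ?B) (?D +++ straight_path (s n) (s (Suc n)))"
      using pA iA iB iD iE eA
      by (intro homotopic_paths_coord_convex[OF C])
        (auto simp: path_image_join intro!: path_join_imp)
    then have "homotopic_paths ?T (?A +++ ?B) (?D +++ straight_path (s n) (s (Suc n)))"
      using CT homotopic_paths_subset by blast
    also have "homotopic_paths ?T \<dots> (?D +++ a)"
      using iD CT a(2) by (intro homotopic_paths_join) auto
    finally show "homotopic_paths ?T (?A +++ ?B) (?D +++ a)" .
    show "homotopic_paths ?T h h"
      using h hT by simp
    show "pathfinish (?A +++ ?B) = pathstart h"
      using h by simp
  qed
  also have "homotopic_paths ?T \<dots> (?D +++ (a +++ h))"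
    using iD CT a' h hT by (intro homotopic_paths_sym[OF homotopic_paths_assoc]) auto
  finally have "homotopic_paths ?T (g \<circ> linepath t 1) (?D +++ (a +++ h))" .
  moreover have "path (a +++ h)" "path_image (a +++ h) \<subseteq> W" "pathstart (a +++ h) = s n"
    "pathfinish (a +++ h) = s N"
    using a a' h by (auto simp: path_image_join intro!: path_join_imp)
  ultimately show ?case
    unfolding t_def by blast
qed

text \<open>With \<open>\<delta>\<close> belonging to \<open>\<epsilon>\<close>, the neighbourhood of radius \<open>\<delta> / 3\<close> works: consecutive points of a
  fine subdivision of a loop and the points of \<open>S\<close> next to them are joined by three steps of length
  less than \<open>\<delta> / 3\<close>, so the sampled chain has steps of length less than \<open>\<delta>\<close>.\<close>
lemma movable_if_weakly_chained:
  assumes wc: "weakly_chained S dist" and cS: "compact S" and S: "S \<subseteq> hilbert_cube" and p: "p \<in> S"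
  shows "pointed_1_movable_in_cube S p"
  unfolding pointed_1_movable_in_cube_def
proof (intro allI impI)
  fix U
  assume U: "cube_nbhd S U"
  obtain \<epsilon> where \<epsilon>: "\<epsilon> > 0" "tube S \<epsilon> \<subseteq> U"
    using cube_nbhd_contains_tube[OF U cS] .
  obtain \<delta>0 where \<delta>0: "\<delta>0 > 0" and wc':
    "\<And>x y \<tau>. x \<in> S \<Longrightarrow> y \<in> S \<Longrightarrow> dist x y < \<delta>0 \<Longrightarrow> \<tau> > 0 \<Longrightarrow>
       \<exists>\<alpha>. eps_chain_from_to S dist \<tau> x y \<alpha> \<and> eps_homotopic S dist \<epsilon> [x, y] \<alpha>"
    using wc \<epsilon>(1) unfolding weakly_chained_iff by metis
  define \<delta> where "\<delta> = min \<delta>0 \<epsilon>"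
  define r where "r = \<delta> / 3"
  have r: "r > 0" "3 * r \<le> \<delta>" "\<delta> \<le> \<epsilon>" "\<delta> \<le> \<delta>0" "r \<le> \<epsilon>"
    using \<delta>0 \<epsilon> by (auto simp: r_def \<delta>_def)
  have "\<exists>h. loop_in W p h \<and> homotopic_paths U g h"
    if W: "cube_nbhd S W" and g: "loop_in (tube S r) p g" for W g
  proof -
    obtain \<tau> where \<tau>: "\<tau> > 0" "tube S \<tau> \<subseteq> W"
      using cube_nbhd_contains_tube[OF W cS] .
    have SW: "S \<subseteq> W"
      using subset_tube[OF S \<tau>(1)] \<tau>(2) by blast
    have step: "\<exists>a. path_image a \<subseteq> W \<and> homotopic_paths (tube S \<epsilon>) (straight_path x y) a"
      if xy: "x \<in> S" "y \<in> S" "dist x y < \<delta>" for x y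
    proof -
      obtain \<alpha> where \<alpha>: "eps_chain_from_to S dist \<tau> x y \<alpha>" "eps_homotopic S dist \<epsilon> [x, y] \<alpha>"
        using wc'[of x y \<tau>] xy r \<tau> by auto
      let ?C = "hilbert_cube \<inter> ball x \<epsilon>"
      have C: "coord_convex ?C" and xyC: "x \<in> ?C" "y \<in> ?C"
        using coord_convex_cube_ball xy S r \<epsilon> by auto
      have "homotopic_paths ?C (straight_path x y) (polygon [x, y])"
        using coord_convexD[OF C] xyC polygon_in_coord_convex[OF C, of "[x, y]"]
        by (intro homotopic_paths_coord_convex[OF C]) (auto intro!: path_join_imp)
      then have "homotopic_paths (tube S \<epsilon>) (straight_path x y) (polygon [x, y])"
        by (rule homotopic_paths_subset[OF _ cube_ball_subset_tube[OF xy(1)]])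
      also have "homotopic_paths (tube S \<epsilon>) \<dots> (polygon \<alpha>)"
        by (rule homotopic_polygon[OF S \<epsilon>(1) \<alpha>(2)])
      finally show ?thesis
        using polygon_in_tube[OF S \<tau>(1)] \<alpha>(1) \<tau>(2) unfolding eps_chain_from_to_def by blast
    qed
    have g': "path g" "path_image g \<subseteq> tube S r" "g 0 = p" "g 1 = p"
      using g by (auto simp: loop_in_def pathstart_def pathfinish_def)
    have "uniformly_continuous_on {0..1} g"
      using g'(1) by (auto simp: path_def intro: compact_uniformly_continuous)
    then obtain \<eta> where \<eta>: "\<eta> > 0"
      "\<And>u v. u \<in> {0..1} \<Longrightarrow> v \<in> {0..1} \<Longrightarrow> dist u v < \<eta> \<Longrightarrow> dist (g u) (g v) < r"
      using r(1) unfolding uniformly_continuous_on_def by (metis dist_commute)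
    obtain n where n: "1 / real (Suc n) < \<eta>"
      using nat_approx_posE[OF \<eta>(1)] by blast
    define N where "N = Suc n"
    have N: "N > 0" "1 / real N < \<eta>"
      using n by (simp_all add: N_def)
    have fine: "dist (g (real j / real N)) (g t) < r"
      if "j < N" "real j / real N \<le> t" "t \<le> real (Suc j) / real N" for j t
    proof (rule \<eta>(2))
      have "real (Suc j) / real N \<le> 1" "0 \<le> real j / real N"
        using that(1) by simp_all
      then have "0 \<le> t" "t \<le> 1"
        using that(2,3) by linarith+
      then show "t \<in> {0..1}"
        by simp
      show "real j / real N \<in> {0..1}"
        using that(1) by simp
      have "t - real j / real N \<le> 1 / real N"
        using that(3) by (simp add: add_divide_distrib)
      then show "dist (real j / real N) t < \<eta>"
        using that(2) N(2) by (simp add: dist_real_def)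
    qed
    have "\<exists>q. q \<in> S \<and> dist (g (real j / real N)) q < r \<and> (j = 0 \<or> j = N \<longrightarrow> q = p)"
      if "j \<le> N" for j
    proof (cases "j = 0 \<or> j = N")
      case True
      then show ?thesis
        using g' p r(1) N(1) by auto
    next
      case False
      have "g (real j / real N) \<in> path_image g"
        using that N(1) by (simp add: path_image_def)
      then have "g (real j / real N) \<in> tube S r"
        using g'(2) by blast
      then show ?thesis
        using False by (auto simp: tube_def dist_commute)
    qed
    then obtain s where s: "\<And>j. j \<le> N \<Longrightarrow> s j \<in> S \<and> dist (g (real j / real N)) (s j) < r \<and>
        (j = 0 \<or> j = N \<longrightarrow> s j = p)"
      by metis
    have "\<exists>h. path h \<and> path_image h \<subseteq> W \<and> pathstart h = s 0 \<and> pathfinish h = s N \<and>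
      homotopic_paths (tube S \<epsilon>) (g \<circ> linepath (real 0 / real N) 1)
        (straight_path (g (real 0 / real N)) (s 0) +++ h)"
      by (rule shrink_path_along_chain[OF S SW r(1-3) step g'(1,2) N(1) fine])
        (use s g'(4) in \<open>auto simp: pathfinish_def\<close>)
    then obtain h where h: "path h" "path_image h \<subseteq> W" "pathstart h = p" "pathfinish h = p"
      "homotopic_paths (tube S \<epsilon>) (g \<circ> linepath 0 1) (straight_path p p +++ h)"
      using s[of 0] s[of N] g'(3) by auto
    have "g \<circ> linepath 0 1 = g"
      by (auto simp: linepath_def)
    then have "homotopic_paths U g (straight_path p p +++ h)"
      using h(5) \<epsilon>(2) homotopic_paths_subset by metis
    moreover have "loop_in W p (straight_path p p +++ h)"
      using h SW p by (auto simp: loop_in_def path_image_join intro!: path_join_imp)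
    ultimately show ?thesis by blast
  qed
  moreover have "cube_nbhd S (tube S r)" "tube S r \<subseteq> U"
    using cube_nbhd_tube[OF S r(1)] tube_mono[OF r(5)] \<epsilon>(2) by blast+
  ultimately show "\<exists>V. cube_nbhd S V \<and> V \<subseteq> U \<and>
      (\<forall>W. cube_nbhd S W \<longrightarrow> (\<forall>g. loop_in V p g \<longrightarrow> (\<exists>h. loop_in W p h \<and> homotopic_paths U g h)))"
    by blast
qed

section \<open>Connected movable sets are weakly chained\<close>

text \<open>Points of \<open>S\<close> within \<open>r\<close> of neighbouring points of a grid that is finer than \<open>r\<close> are within \<open>3 r\<close>
  of each other; hence the factor \<open>3\<close>. Two radii occur because \<open>h\<close> may run closer to \<open>S\<close> than the
  homotopy does, and the chain obtained from it must profit from this. As \<open>g\<close> stays in one ball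
  around \<open>x\<close>, the chain \<open>[x, y]\<close> samples it well enough.\<close>
lemma chain_of_homotopic_path:
  fixes S :: "'a::metric_space set"
  assumes hom: "homotopic_paths U g h" and U: "U \<subseteq> (\<Union>s\<in>S. ball s r)"
    and h: "path_image h \<subseteq> (\<Union>s\<in>S. ball s r')" and r: "0 < r'" "r' \<le> r"
    and g: "path_image g \<subseteq> ball x r" and x: "x \<in> S" "pathstart g = x" and y: "y \<in> S" "pathfinish g = y"
  shows "\<exists>\<alpha>. eps_chain_from_to S dist (3 * r') x y \<alpha> \<and> eps_homotopic S dist (3 * r) [x, y] \<alpha>"
proof -
  obtain H :: "real \<times> real \<Rightarrow> 'a" where H: "continuous_on ({0..1} \<times> {0..1}) H" "H \<in> {0..1} \<times> {0..1} \<rightarrow> U"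
    and Hg: "\<forall>t\<in>{0..1}. H (0, t) = g t" and Hh: "\<forall>t\<in>{0..1}. H (1, t) = h t"
    and "\<forall>t\<in>{0..1}. pathstart (H \<circ> Pair t) = pathstart g \<and> pathfinish (H \<circ> Pair t) = pathfinish g"
    using hom unfolding homotopic_paths by blast
  then have Hends: "\<forall>t\<in>{0..1}. H (t, 0) = x \<and> H (t, 1) = y"
    using x(2) y(2) by (simp add: pathstart_def pathfinish_def)
  have "uniformly_continuous_on ({0..1} \<times> {0..1}) H"
    using H(1) by (intro compact_uniformly_continuous compact_Times) auto
  then obtain \<eta> where \<eta>: "\<eta> > 0"
    "\<And>u v. u \<in> {0..1} \<times> {0..1} \<Longrightarrow> v \<in> {0..1} \<times> {0..1} \<Longrightarrow> dist u v < \<eta> \<Longrightarrow> dist (H u) (H v) < r'"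
    using r(1) unfolding uniformly_continuous_on_def by (metis dist_commute)
  obtain n where n: "1 / real (Suc n) < \<eta> / 2"
    using nat_approx_posE[of "\<eta> / 2"] \<eta>(1) by auto
  define N where "N = Suc n"
  define q where "q i j = H (real i / real N, real j / real N)" for i j :: nat
  have N: "N > 0" "2 / real N < \<eta>"
    using n by (simp_all add: N_def)
  have unit: "real i / real N \<in> {0..1}" if "i \<le> N" for i
    using that N(1) by simp
  have close: "dist (q i j) (q i' j') < r'"
    if "i \<le> N" "j \<le> N" "i' \<le> N" "j' \<le> N" "i' = i \<or> i' = Suc i \<or> i = Suc i'" "j' = j \<or> j' = Suc j" for i j i' j'
    unfolding q_def
  proof (rule \<eta>(2))
    have d: "dist (real k / real N) (real k' / real N) \<le> 1 / real N"
      if "k' = k \<or> k' = Suc k \<or> k = Suc k'" for k k'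
      using that by (auto simp: dist_real_def diff_divide_distrib[symmetric])
    have "dist (real i / real N, real j / real N) (real i' / real N, real j' / real N)
        \<le> dist (real i / real N) (real i' / real N) + dist (real j / real N) (real j' / real N)"
      unfolding dist_Pair_Pair by (rule sqrt_sum_squares_le_sum) auto
    also have "\<dots> \<le> 1 / real N + 1 / real N"
      using that by (intro add_mono d) auto
    also have "\<dots> < \<eta>"
      using N(2) by simp
    finally show "dist (real i / real N, real j / real N) (real i' / real N, real j' / real N) < \<eta>" .
  qed (use that unit in auto)
  \<comment> \<open>Points of \<open>S\<close> next to the grid: the left and right sides stay at the endpoints, the row of
    \<open>g\<close> stays at \<open>x\<close> until its last point, and the row of \<open>h\<close> is followed more closely.\<close>
  have "\<exists>z. i \<le> N \<longrightarrow> j \<le> N \<longrightarrow> z \<in> S \<and> dist z (q i j) < r \<and> (i = N \<longrightarrow> dist z (q i j) < r') \<and>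
      (j = 0 \<longrightarrow> z = x) \<and> (j = N \<longrightarrow> z = y) \<and> (i = 0 \<and> j < N \<longrightarrow> z = x)" for i j
  proof (cases "i \<le> N \<and> j \<le> N")
    case True
    then have u: "real i / real N \<in> {0..1}" "real j / real N \<in> {0..1}"
      using unit by auto
    have qU: "q i j \<in> U"
      using H(2) u unfolding q_def by blast
    consider "j = 0" | "j = N" | "0 < j" "j < N" "i = 0" | "0 < j" "j < N" "i = N"
      | "0 < j" "j < N" "0 < i" "i < N"
      using True by linarith
    then show ?thesis
    proof cases
      case 1
      then have "q i j = x"
        using bspec[OF Hends u(1)] by (simp add: q_def)
      then show ?thesis using 1 x(1) r N(1) by (intro exI[of _ x]) auto
    next
      case 2
      then have "q i j = y"
        using bspec[OF Hends u(1)] N(1) by (simp add: q_def)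
      then show ?thesis using 2 y(1) r N(1) by (intro exI[of _ y]) auto
    next
      case 3
      then have "q i j = g (real j / real N)"
        using bspec[OF Hg u(2)] by (simp add: q_def)
      then have "q i j \<in> path_image g"
        using u(2) by (simp add: path_image_def)
      then have "q i j \<in> ball x r"
        using g by blast
      then show ?thesis using 3 x(1) N(1) by (intro exI[of _ x]) auto
    next
      case 4
      then have "q i j = h (real j / real N)"
        using bspec[OF Hh u(2)] N(1) by (simp add: q_def)
      then have "q i j \<in> path_image h"
        using u(2) by (simp add: path_image_def)
      then obtain z where "z \<in> S" "dist z (q i j) < r'"
        using h by fastforce
      then show ?thesis using 4 r by (intro exI[of _ z]) auto
    next
      case 5
      then obtain z where "z \<in> S" "dist z (q i j) < r"
        using qU U by fastforce
      then show ?thesis using 5 by (intro exI[of _ z]) auto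
    qed
  qed auto
  then obtain s where s: "\<And>i j. i \<le> N \<Longrightarrow> j \<le> N \<Longrightarrow> s i j \<in> S \<and> dist (s i j) (q i j) < r \<and>
      (i = N \<longrightarrow> dist (s i j) (q i j) < r') \<and>
      (j = 0 \<longrightarrow> s i j = x) \<and> (j = N \<longrightarrow> s i j = y) \<and> (i = 0 \<and> j < N \<longrightarrow> s i j = x)"
    by metis
  have via: "dist a b < 3 * \<rho>" if "dist a c < \<rho>" "dist c d < \<rho>" "dist b d < \<rho>" for a b c d :: 'a and \<rho>
    using dist_triangle[of a b c] dist_triangle[of c b d] that by (simp add: dist_commute)
  have s_near: "dist (s i j) (s i' j') < 3 * r"
    if "i \<le> N" "j \<le> N" "i' \<le> N" "j' \<le> N" "i' = i \<or> i' = Suc i \<or> i = Suc i'" "j' = j \<or> j' = Suc j" for i j i' j'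
    using s[of i j] s[of i' j'] close[OF that] that r(2) by (intro via[of _ "q i j" _ "q i' j'"]) auto
  have s_S: "s i j \<in> S" if "i \<le> N" "j \<le> N" for i j
    using s that by blast
  have s_ends: "s i 0 = x" "s i N = y" if "i \<le> N" for i
    using s[of i 0] s[of i N] that by auto
  let ?row = "\<lambda>i. map (s i) [0..<Suc N]"
  have row_step: "eps_homotopic S dist (3 * r) (?row i) (?row (Suc i))" if "Suc i \<le> N" for i
    using that s_ends s_S s_near by (intro eps_homotopic_ladder) auto
  have row0: "?row 0 = replicate (Suc n) x @ [y]"
  proof -
    have "map (s 0) [0..<N] = map (\<lambda>_. x) [0..<N]"
      using s[of 0] by (intro map_cong) auto
    then show ?thesis
      using s[of 0 N] by (simp add: N_def map_replicate_const)
  qed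
  have "dist x y < 3 * r"
  proof -
    have "y \<in> ball x r"
      using g y(2) pathfinish_in_path_image by blast
    then show ?thesis
      using r by simp
  qed
  then have "eps_homotopic S dist (3 * r) [x, y] (?row 0)"
    unfolding row0 using x y r by (intro eps_homotopic_repeat_start) auto
  then have "eps_homotopic S dist (3 * r) [x, y] (?row i)" if "i \<le> N" for i
    using that
  proof (induction i)
    case (Suc i)
    then show ?case
      using row_step[of i] eps_homotopic_trans by (metis Suc_leD)
  qed simp
  moreover have "eps_chain_from_to S dist (3 * r') (s N 0) (s N N) (?row N)"
  proof (rule eps_chain_map_upt)
    show "s N j \<in> S" if "j \<le> N" for j
      using s_S that by blast
    show "dist (s N j) (s N (Suc j)) < 3 * r'" if "j < N" for j
      using s[of N j] s[of N "Suc j"] close[of N j N "Suc j"] that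
      by (intro via[of _ "q N j" _ "q N (Suc j)"]) auto
  qed
  ultimately show ?thesis
    using s_ends[of N] by auto
qed

text \<open>All of \<open>\<sigma>\<close>, \<open>reversepath \<gamma>\<close> and \<open>\<gamma>'\<close> are reparametrizations of pieces of the product path
  \<open>\<gamma> +++ (\<sigma> +++ reversepath \<gamma>')\<close>, in which \<open>\<gamma>\<close> occupies the parameters up to \<open>1/2\<close> and \<open>\<sigma>\<close> those
  between \<open>1/2\<close> and \<open>3/4\<close>. The cancellation is thus a homotopy of parameters: from \<open>1/2\<close> straight
  to \<open>3/4\<close>, or with detours via \<open>0\<close> and \<open>1\<close>.\<close>
lemma homotopic_paths_unconjugate:
  fixes \<sigma> :: "real \<Rightarrow> 'a::metric_space"
  assumes paths: "path \<gamma>" "path \<sigma>" "path \<gamma>'"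
    and ends: "pathfinish \<gamma> = pathstart \<sigma>" "pathfinish \<sigma> = pathfinish \<gamma>'"
    and hom: "homotopic_paths U (\<gamma> +++ (\<sigma> +++ reversepath \<gamma>')) h"
  shows "homotopic_paths U \<sigma> (reversepath \<gamma> +++ (h +++ \<gamma>'))"
proof -
  let ?P = "\<gamma> +++ (\<sigma> +++ reversepath \<gamma>')"
  have P: "path ?P" "path_image ?P \<subseteq> U"
    using homotopic_paths_imp_path[OF hom] homotopic_paths_imp_subset[OF hom] by auto
  have im: "path_image \<gamma> \<subseteq> U" "path_image \<sigma> \<subseteq> U" "path_image \<gamma>' \<subseteq> U"
    using P(2) ends by (auto simp: path_image_join)
  have ends_h: "pathstart h = pathstart \<gamma>" "pathfinish h = pathstart \<gamma>'"
    using homotopic_paths_imp_pathstart[OF hom] homotopic_paths_imp_pathfinish[OF hom] by auto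
  let ?\<phi> = "linepath (1/2) 0 +++ (linepath 0 1 +++ linepath 1 (3/4)) :: real \<Rightarrow> real"
  have \<sigma>: "homotopic_paths U \<sigma> (?P \<circ> linepath (1/2) (3/4))"
  proof (rule homotopic_paths_eq[OF paths(2) im(2)])
    fix t :: real
    assume t: "t \<in> {0..1}"
    show "\<sigma> t = (?P \<circ> linepath (1/2) (3/4)) t"
    proof (cases "t = 0")
      case True
      then show ?thesis
        using ends by (simp add: joinpaths_def linepath_def pathstart_def pathfinish_def)
    next
      case False
      have lin: "linepath (1/2) (3/4) t = 1/2 + t/4"
        by (simp add: linepath_def field_simps)
      show ?thesis
        unfolding comp_def lin using t False by (simp add: joinpaths_def algebra_simps)
    qed
  qed
  have \<gamma>: "homotopic_paths U (reversepath \<gamma>) (?P \<circ> linepath (1/2) 0)"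
  proof (rule homotopic_paths_eq)
    fix t :: real
    assume t: "t \<in> {0..1}"
    have lin: "linepath (1/2) 0 t = (1 - t)/2"
      by (simp add: linepath_def)
    show "reversepath \<gamma> t = (?P \<circ> linepath (1/2) 0) t"
      unfolding comp_def lin using t by (simp add: joinpaths_def reversepath_def diff_divide_distrib)
  qed (use paths im in auto)
  have \<gamma>': "homotopic_paths U \<gamma>' (?P \<circ> linepath 1 (3/4))"
  proof (rule homotopic_paths_eq[OF paths(3) im(3)])
    fix t :: real
    assume t: "t \<in> {0..1}"
    have lin: "linepath 1 (3/4) t = 1 - t/4"
      by (simp add: linepath_def field_simps)
    show "\<gamma>' t = (?P \<circ> linepath 1 (3/4)) t"
    proof (cases "t = 1")
      case True
      then show ?thesis
        using ends by (simp add: joinpaths_def linepath_def pathstart_def pathfinish_def)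
    next
      case False
      then show ?thesis
        unfolding comp_def lin using t by (simp add: joinpaths_def reversepath_def algebra_simps)
    qed
  qed
  have id: "?P \<circ> linepath 0 1 = ?P"
    by (auto simp: linepath_def)
  have "homotopic_paths U \<sigma> (?P \<circ> linepath (1/2) (3/4))"
    by (rule \<sigma>)
  also have "homotopic_paths U \<dots> (?P \<circ> ?\<phi>)"
    by (intro homotopic_paths_reparametrized[OF P])
      (auto simp: path_image_join closed_segment_eq_real_ivl)
  also have "?P \<circ> ?\<phi> = (?P \<circ> linepath (1/2) 0) +++ (?P +++ (?P \<circ> linepath 1 (3/4)))"
    by (simp only: path_compose_join id)
  also have "homotopic_paths U \<dots> (reversepath \<gamma> +++ (h +++ \<gamma>'))"
    using \<gamma> \<gamma>' hom ends
    by (intro homotopic_paths_join)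
      (auto simp: homotopic_paths_sym_eq pathstart_compose pathfinish_compose linepath_def joinpaths_def
        pathstart_def pathfinish_def reversepath_def)
  finally show ?thesis .
qed

text \<open>The loop condition is applied to the loop \<open>\<gamma> +++ (\<sigma> +++ reversepath \<gamma>')\<close>, where \<open>\<sigma>\<close> is the edge
  from \<open>x\<close> to \<open>y\<close>. The paths \<open>\<gamma>\<close> and \<open>\<gamma>'\<close> depend on the target neighbourhood, which is harmless
  because the conclusion concerns only \<open>\<sigma>\<close>, and they cancel.\<close>
lemma weakly_chained_if_movable:
  assumes mov: "pointed_1_movable_in_cube S p" and "connected S" and cS: "compact S"
    and S: "S \<subseteq> hilbert_cube" and p: "p \<in> S"
  shows "weakly_chained S dist"
  unfolding weakly_chained_iff
proof (intro conjI allI impI)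
  show cc: "chain_connected S dist"
    by (rule chain_connected_if_connected[OF \<open>connected S\<close>])
  fix \<epsilon> :: real
  assume "\<epsilon> > 0"
  define r where "r = \<epsilon> / 3"
  have r: "r > 0" "3 * r = \<epsilon>"
    using \<open>\<epsilon> > 0\<close> by (simp_all add: r_def)
  let ?U = "tube S r"
  obtain V where V: "cube_nbhd S V" "V \<subseteq> ?U" and
    mov': "\<forall>W. cube_nbhd S W \<longrightarrow>
      (\<forall>g. loop_in V p g \<longrightarrow> (\<exists>h. loop_in W p h \<and> homotopic_paths ?U g h))"
    using mov[unfolded pointed_1_movable_in_cube_def, rule_format, OF cube_nbhd_tube[OF S r(1)]]
    by blast
  obtain \<delta>0 where \<delta>0: "\<delta>0 > 0" "tube S \<delta>0 \<subseteq> V"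
    using cube_nbhd_contains_tube[OF V(1) cS] .
  define \<delta> where "\<delta> = min \<delta>0 r"
  have \<delta>: "\<delta> > 0" "\<delta> \<le> r" "tube S \<delta> \<subseteq> V"
    using \<delta>0 r tube_mono[of \<delta> \<delta>0 S] by (auto simp: \<delta>_def)
  have "\<exists>\<alpha>. eps_chain_from_to S dist \<tau> x y \<alpha> \<and> eps_homotopic S dist \<epsilon> [x, y] \<alpha>"
    if xy: "x \<in> S" "y \<in> S" "dist x y < \<delta>" and "\<tau> > 0" for x y \<tau>
  proof -
    define r' where "r' = min (\<tau> / 3) \<delta>"
    have r': "r' > 0" "r' \<le> \<delta>" "3 * r' \<le> \<tau>"
      using \<open>\<tau> > 0\<close> \<delta> by (auto simp: r'_def)
    let ?W = "tube S r'"
    have WV: "?W \<subseteq> V"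
      using tube_mono[OF r'(2)] \<delta>(3) by blast
    have "\<exists>\<gamma>. path \<gamma> \<and> path_image \<gamma> \<subseteq> ?W \<and> pathstart \<gamma> = p \<and> pathfinish \<gamma> = z" if zS: "z \<in> S" for z
    proof -
      obtain c where "eps_chain_from_to S dist r' p z c"
        using cc p zS r'(1) unfolding chain_connected_def by blast
      then show ?thesis
        using polygon_in_tube[OF S r'(1), of c]
        by (intro exI[of _ "polygon c"]) (auto simp: eps_chain_from_to_def eps_chain_def)
    qed
    then obtain \<gamma> \<gamma>' where \<gamma>: "path \<gamma>" "path_image \<gamma> \<subseteq> ?W" "pathstart \<gamma> = p" "pathfinish \<gamma> = x"
      and \<gamma>': "path \<gamma>'" "path_image \<gamma>' \<subseteq> ?W" "pathstart \<gamma>' = p" "pathfinish \<gamma>' = y"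
      using xy by metis
    let ?\<sigma> = "straight_path x y"
    have \<sigma>: "path_image ?\<sigma> \<subseteq> hilbert_cube \<inter> ball x \<delta>"
      using straight_path_in_cube_ball xy S by blast
    then have "path_image ?\<sigma> \<subseteq> V"
      using cube_ball_subset_tube[OF xy(1)] \<delta>(3) by blast
    then have "loop_in V p (\<gamma> +++ (?\<sigma> +++ reversepath \<gamma>'))"
      using \<gamma> \<gamma>' WV by (auto simp: loop_in_def path_image_join intro!: path_join_imp)
    then obtain h where h: "loop_in ?W p h" "homotopic_paths ?U (\<gamma> +++ (?\<sigma> +++ reversepath \<gamma>')) h"
      using mov' cube_nbhd_tube[OF S r'(1)] by blast
    have "homotopic_paths ?U ?\<sigma> (reversepath \<gamma> +++ (h +++ \<gamma>'))"
      using \<gamma> \<gamma>' h(2) by (intro homotopic_paths_unconjugate) auto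
    moreover have "path_image (reversepath \<gamma> +++ (h +++ \<gamma>')) \<subseteq> ?W"
      using \<gamma> \<gamma>' h(1) by (auto simp: loop_in_def path_image_join)
    ultimately have "\<exists>\<alpha>. eps_chain_from_to S dist (3 * r') x y \<alpha> \<and>
        eps_homotopic S dist (3 * r) [x, y] \<alpha>"
      using r r' \<delta> \<sigma> xy
      by (intro chain_of_homotopic_path[of ?U ?\<sigma> "reversepath \<gamma> +++ (h +++ \<gamma>')"])
        (auto simp: tube_def subset_iff)
    then obtain \<alpha> where \<alpha>: "eps_chain_from_to S dist (3 * r') x y \<alpha>" "eps_homotopic S dist \<epsilon> [x, y] \<alpha>"
      using r(2) by auto
    have "eps_chain_from_to S dist \<tau> (id x) (id y) (map id \<alpha>)"
      by (rule eps_chain_from_to_map[of id S S dist "3 * r'"]) (use \<alpha>(1) r'(3) in auto)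
    then show ?thesis
      using \<alpha>(2) by auto
  qed
  then show "\<exists>\<delta>>0. \<forall>x\<in>S. \<forall>y\<in>S. dist x y < \<delta> \<longrightarrow>
      (\<forall>\<tau>>0. \<exists>\<alpha>. eps_chain_from_to S dist \<tau> x y \<alpha> \<and> eps_homotopic S dist \<epsilon> [x, y] \<alpha>)"
    using \<delta>(1) by blast
qed

section \<open>The characterization\<close>

lemma uniformly_continuous_on_compact_Metric_space:
  assumes M: "Metric_space M d" and M': "Metric_space M' d'"
    and "compact_space (Metric_space.mtopology M d)"
    and "continuous_map (Metric_space.mtopology M d) (Metric_space.mtopology M' d') f"
    and "\<epsilon> > 0"
  shows "\<exists>\<delta>>0. \<forall>x\<in>M. \<forall>y\<in>M. d x y < \<delta> \<longrightarrow> d' (f x) (f y) < \<epsilon>"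
proof -
  have "uniformly_continuous_map (metric (M, d)) (metric (M', d')) f"
    by (rule continuous_imp_uniformly_continuous_map)
      (use assms(3,4) in \<open>simp add: mtopology_of_def Metric_space.mspace_metric[OF M]
        Metric_space.mdist_metric[OF M] Metric_space.mspace_metric[OF M']
        Metric_space.mdist_metric[OF M']\<close>)
  then have "\<forall>\<epsilon>>0. \<exists>\<delta>>0. \<forall>x\<in>M. \<forall>y\<in>M. d y x < \<delta> \<longrightarrow> d' (f y) (f x) < \<epsilon>"
    by (simp add: uniformly_continuous_map_def Metric_space.mspace_metric[OF M]
        Metric_space.mdist_metric[OF M] Metric_space.mspace_metric[OF M']
        Metric_space.mdist_metric[OF M'])
  then show ?thesis
    using \<open>\<epsilon> > 0\<close> by blast
qed

theorem mainTheorem4: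
  fixes X :: "'a topology"
    and d :: "'a \<Rightarrow> 'a \<Rightarrow> real"
    and e :: "'a \<Rightarrow> nat \<Rightarrow> real"
    and x\<^sub>0 :: 'a
  assumes "compact_space X"
    and "Metric_space (topspace X) d"
    and "Metric_space.mtopology (topspace X) d = X"
    and "embedding_map X (top_of_set hilbert_cube) e"
    and "x\<^sub>0 \<in> topspace X"
  shows "weakly_chained (topspace X) d \<longleftrightarrow> pointed_1_movable X e x\<^sub>0"
proof -
  define S where "S = e ` topspace X"
  have S: "S \<subseteq> hilbert_cube"
  proof -
    have "continuous_map X (top_of_set hilbert_cube) e"
      using assms(4) homeomorphic_imp_continuous_map continuous_map_into_fulltopology
      unfolding embedding_map_def by blast
    then have "e \<in> topspace X \<rightarrow> hilbert_cube"
      using continuous_map_funspace by fastforce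
    then show ?thesis
      unfolding S_def by blast
  qed
  have "subtopology (top_of_set hilbert_cube) S = top_of_set S"
    using S by (simp add: subtopology_subtopology inf.absorb2)
  then have hom: "homeomorphic_map X (top_of_set S) e"
    using assms(4) by (simp add: embedding_map_def S_def)
  then obtain g where g: "homeomorphic_maps X (top_of_set S) e g"
    using homeomorphic_map_maps by blast
  have hs: "X homeomorphic_space top_of_set S"
    using hom homeomorphic_map_imp_homeomorphic_space by blast
  have cS: "compact S"
    using homeomorphic_compact_space[OF hs] assms(1)
    by (simp add: compact_space_subtopology compactin_euclidean_iff compact_space_def)
  have con: "connected_space X \<longleftrightarrow> connected S"
    using homeomorphic_connected_space[OF hs]
    by (simp add: connectedin_def flip: connectedin_iff_connected)
  have msp: "Metric_space S dist"
    by (simp add: Met_TC.subspace)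
  have mtop: "Metric_space.mtopology S dist = top_of_set S"
    using Submetric.mtopology_submetric[of UNIV dist S]
    by (simp add: Submetric_def Submetric_axioms_def Met_TC.Metric_space_axioms)
  have p: "e x\<^sub>0 \<in> S"
    using assms(5) by (simp add: S_def)
  have cont: "continuous_map X (top_of_set S) e" "continuous_map (top_of_set S) X g"
    and ge: "\<And>x. x \<in> topspace X \<Longrightarrow> g (e x) = x" and eg: "\<And>y. y \<in> S \<Longrightarrow> e (g y) = y"
    using g unfolding homeomorphic_maps_def by auto
  have gS: "g ` S \<subseteq> topspace X"
    using ge by (auto simp: S_def)
  have eX: "e ` topspace X \<subseteq> S"
    by (simp add: S_def)
  have uce: "\<exists>\<delta>>0. \<forall>x\<in>topspace X. \<forall>y\<in>topspace X. d x y < \<delta> \<longrightarrow> dist (e x) (e y) < \<epsilon>" if "\<epsilon> > 0" for \<epsilon>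
    by (rule uniformly_continuous_on_compact_Metric_space[OF assms(2) msp])
      (use assms(1,3) mtop cont that in auto)
  have ucg: "\<exists>\<delta>>0. \<forall>x\<in>S. \<forall>y\<in>S. dist x y < \<delta> \<longrightarrow> d (g x) (g y) < \<epsilon>" if "\<epsilon> > 0" for \<epsilon>
    by (rule uniformly_continuous_on_compact_Metric_space[OF msp assms(2)])
      (use assms(3) mtop cont cS that in \<open>auto simp: compact_space_subtopology\<close>)
  have "weakly_chained (topspace X) d \<longleftrightarrow> weakly_chained S dist"
    using weakly_chained_transfer[of "topspace X" d e S g dist, OF _ eX gS eg uce ucg]
      weakly_chained_transfer[of S dist g "topspace X" e d, OF _ gS eX ge ucg uce] by blast
  also have "\<dots> \<longleftrightarrow> connected S \<and> pointed_1_movable_in_cube S (e x\<^sub>0)"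
    using movable_if_weakly_chained[OF _ cS S p] weakly_chained_if_movable[OF _ _ cS S p]
      connected_if_chain_connected[OF _ cS] weakly_chained_def by blast
  also have "\<dots> \<longleftrightarrow> pointed_1_movable X e x\<^sub>0"
    by (simp add: pointed_1_movable_def con S_def)
  finally show ?thesis .
qed

end
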